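(* Besides the complete graph $K_5$ and its complement $\overline{K_5}$, no graph on five vertices has nonlocal symmetry.
   Context: Graphs are finite and simple. For a graph $G$, in the $G$-automorphism game Alice and Bob receive vertices $i,j\in V(G)$ and answer with vertices $l,k\in V(G)$ respectively (without communicating); they win iff $\mathrm{rel}(i,j)=\mathrm{rel}(l,k)$, where $\mathrm{rel}$ records whether two vertices are equal, distinct and adjacent, or distinct and non-adjacent. A correlation is a function $p:V(G)^4\to[0,1]$, written $p(l,k|i,j)$, with $\sum_{l,k}p(l,k|i,j)=1$ for all $i,j$; it is winning if $p(l,k|i,j)=0$ whenever $\mathrm{rel}(i,j)\ne\mathrm{rel}(l,k)$. The winning classical correlations are the convex combinations of the correlations $p_\pi$, $\pi\in\mathrm{Aut}(G)$, where $p_\pi(l,k|i,j)=1$ if $l=\pi(i)$, $k=\pi(j)$ and $0$ otherwise. A quantum correlation is one of the form $p(l,k|i,j)=\psi^*M_{il}N_{jk}\psi$ with $\psi$ a unit vector in a Hilbert space $\mathcal H$ and $M_{il},N_{jk}\in B(\mathcal H)$ positive semidefinite, $\sum_lM_{il}=\mathbf 1=\sum_kN_{jk}$, and $M_{il}N_{jk}=N_{jk}M_{il}$ for all indices. The graph $G$ has (admits) nonlocal symmetry if there is a winning quantum correlation for the $G$-automorphism game that is not classical. It is known that $p$ is a winning quantum correlation for the $G$-automorphism game iff there is a tracial state $\tau$ on $C(\mathrm{Qut}(G))$ with $p(l,k|i,j)=\tau(u_{il}u_{jk})$; here $C(\mathrm{Qut}(G))$ is the universal unital $C^*$-algebra generated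 by $u_{ij}$, $i,j\in V(G)$, subject to $u_{ij}=u_{ij}^*=u_{ij}^2$, $\sum_ku_{ik}=\mathbf 1=\sum_ku_{ki}$ and $UA_G=A_GU$, where $U=(u_{ij})$ and $A_G$ is the adjacency matrix. *)

theory Defs
  imports "HOL-Analysis.Analysis" "Graph_Theory.Kuratowski"
begin

section \<open>Complex Hilbert spaces and operators\<close>

text \<open>The inner product is conjugate-linear in the first and linear in the second argument, so
  \<open>cinner \<psi> (T \<psi>)\<close> is \<open>\<psi>\<^sup>* T \<psi>\<close>. Definiteness follows from \<open>norm_eq_sqrt_cinner\<close>, and
  completeness is part of class \<open>banach\<close>.\<close>

class complex_hilbert_space = banach +
  fixes scaleC :: "complex \<Rightarrow> 'a \<Rightarrow> 'a" (infixr \<open>*\<^sub>C\<close> 75)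
    and cinner :: "'a \<Rightarrow> 'a \<Rightarrow> complex"
  assumes scaleC_add_right: "c *\<^sub>C (x + y) = c *\<^sub>C x + c *\<^sub>C y"
    and scaleC_add_left: "(c + d) *\<^sub>C x = c *\<^sub>C x + d *\<^sub>C x"
    and scaleC_scaleC: "c *\<^sub>C d *\<^sub>C x = (c * d) *\<^sub>C x"
    and scaleC_of_real: "complex_of_real r *\<^sub>C x = r *\<^sub>R x"
    and cinner_commute: "cinner x y = cnj (cinner y x)"
    and cinner_add_right: "cinner x (y + z) = cinner x y + cinner x z"
    and cinner_scaleC_right: "cinner x (c *\<^sub>C y) = c * cinner x y"
    and cinner_self_ge_zero: "0 \<le> Re (cinner x x)"
    and norm_eq_sqrt_cinner: "norm x = sqrt (Re (cinner x x))"

definition bounded_clinear :: "('h::complex_hilbert_space \<Rightarrow> 'h) \<Rightarrow> bool" where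
  "bounded_clinear T \<longleftrightarrow> bounded_linear T \<and> (\<forall>c x. T (c *\<^sub>C x) = c *\<^sub>C T x)"

definition positive_semidefinite :: "('h::complex_hilbert_space \<Rightarrow> 'h) \<Rightarrow> bool" where
  "positive_semidefinite T \<longleftrightarrow>
     bounded_clinear T \<and> (\<forall>x. cinner x (T x) \<in> \<real> \<and> 0 \<le> Re (cinner x (T x)))"

text \<open>The finite-dimensional spaces \<open>\<complex>\<^sup>n\<close> are instances.\<close>

instantiation vec :: ("{complex_hilbert_space}", finite) complex_hilbert_space
begin

definition scaleC_vec :: "complex \<Rightarrow> 'a ^ 'b \<Rightarrow> 'a ^ 'b" where
  "scaleC_vec c x = (\<chi> i. c *\<^sub>C (x $ i))"

definition cinner_vec :: "'a ^ 'b \<Rightarrow> 'a ^ 'b \<Rightarrow> complex" where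
  "cinner_vec x y = (\<Sum>i\<in>UNIV. cinner (x $ i) (y $ i))"

instance
proof
  fix c d :: complex and r :: real and x y z :: "'a ^ 'b"
  show "c *\<^sub>C (x + y) = c *\<^sub>C x + c *\<^sub>C y" "(c + d) *\<^sub>C x = c *\<^sub>C x + d *\<^sub>C x"
    "c *\<^sub>C d *\<^sub>C x = (c * d) *\<^sub>C x" "complex_of_real r *\<^sub>C x = r *\<^sub>R x"
    by (simp_all add: scaleC_vec_def vec_eq_iff scaleC_add_right scaleC_add_left scaleC_scaleC
        scaleC_of_real)
  show "cinner x y = cnj (cinner y x)"
    unfolding cinner_vec_def cnj_sum by (intro sum.cong refl) (rule cinner_commute)
  show "cinner x (y + z) = cinner x y + cinner x z" "cinner x (c *\<^sub>C y) = c * cinner x y"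
    by (simp_all add: cinner_vec_def scaleC_vec_def cinner_add_right cinner_scaleC_right
        sum.distrib sum_distrib_left)
  show "0 \<le> Re (cinner x x)"
    by (simp add: cinner_vec_def sum_nonneg cinner_self_ge_zero)
  show "norm x = sqrt (Re (cinner x x))"
    by (simp add: cinner_vec_def norm_vec_def L2_set_def norm_eq_sqrt_cinner cinner_self_ge_zero)
qed

end

instantiation complex :: complex_hilbert_space
begin

definition scaleC_complex :: "complex \<Rightarrow> complex \<Rightarrow> complex" where
  "scaleC_complex c x = c * x"

definition cinner_complex :: "complex \<Rightarrow> complex \<Rightarrow> complex" where
  "cinner_complex x y = cnj x * y"

instance
  by standard (auto simp: scaleC_complex_def cinner_complex_def algebra_simps scaleR_conv_of_real
      cmod_def power2_eq_square)

end


section \<open>The graph automorphism game\<close>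

text \<open>A finite simple graph is a \<open>pair_graph\<close>: a finite vertex set \<open>pverts G\<close> with a
  symmetric irreflexive relation \<open>parcs G\<close> on it. A correlation \<open>p(l,k|i,j)\<close> is the
  term \<open>p l k i j\<close>; only its values at vertices of \<open>G\<close> matter.\<close>

definition graph_complement :: "'v pair_pre_digraph \<Rightarrow> 'v pair_pre_digraph" where
  "graph_complement G =
     \<lparr> pverts = pverts G,
       parcs = {(u, v). u \<in> pverts G \<and> v \<in> pverts G \<and> u \<noteq> v \<and> (u, v) \<notin> parcs G} \<rparr>"

datatype vertex_relation = Equal | Adjacent | Nonadjacent

definition rel :: "'v pair_pre_digraph \<Rightarrow> 'v \<Rightarrow> 'v \<Rightarrow> vertex_relation" where
  "rel G i j = (if i = j then Equal else if (i, j) \<in> parcs G then Adjacent else Nonadjacent)"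

type_synonym 'v corr = "'v \<Rightarrow> 'v \<Rightarrow> 'v \<Rightarrow> 'v \<Rightarrow> real"

definition correlation :: "'v pair_pre_digraph \<Rightarrow> 'v corr \<Rightarrow> bool" where
  "correlation G p \<longleftrightarrow>
     (\<forall>l\<in>pverts G. \<forall>k\<in>pverts G. \<forall>i\<in>pverts G. \<forall>j\<in>pverts G. p l k i j \<in> {0..1}) \<and>
     (\<forall>i\<in>pverts G. \<forall>j\<in>pverts G. (\<Sum>l\<in>pverts G. \<Sum>k\<in>pverts G. p l k i j) = 1)"

definition winning :: "'v pair_pre_digraph \<Rightarrow> 'v corr \<Rightarrow> bool" where
  "winning G p \<longleftrightarrow>
     (\<forall>l\<in>pverts G. \<forall>k\<in>pverts G. \<forall>i\<in>pverts G. \<forall>j\<in>pverts G.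
        rel G i j \<noteq> rel G l k \<longrightarrow> p l k i j = 0)"

definition automorphisms :: "'v pair_pre_digraph \<Rightarrow> ('v \<Rightarrow> 'v) set" where
  "automorphisms G =
     {\<pi>. \<pi> permutes pverts G \<and>
          (\<forall>i\<in>pverts G. \<forall>j\<in>pverts G. (\<pi> i, \<pi> j) \<in> parcs G \<longleftrightarrow> (i, j) \<in> parcs G)}"

definition deterministic_corr :: "('v \<Rightarrow> 'v) \<Rightarrow> 'v corr" where
  "deterministic_corr \<pi> l k i j = (if l = \<pi> i \<and> k = \<pi> j then 1 else 0)"

definition winning_classical :: "'v pair_pre_digraph \<Rightarrow> 'v corr \<Rightarrow> bool" where
  "winning_classical G p \<longleftrightarrow>
     (\<exists>w. (\<forall>\<pi>\<in>automorphisms G. 0 \<le> w \<pi>) \<and> (\<Sum>\<pi>\<in>automorphisms G. w \<pi>) = 1 \<and>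
        (\<forall>l\<in>pverts G. \<forall>k\<in>pverts G. \<forall>i\<in>pverts G. \<forall>j\<in>pverts G.
           p l k i j = (\<Sum>\<pi>\<in>automorphisms G. w \<pi> * deterministic_corr \<pi> l k i j)))"

text \<open>HOL cannot quantify over types inside a formula, so the underlying Hilbert space is the type
  parameter \<open>'h\<close>. A statement for all Hilbert spaces is one with \<open>'h\<close> free.\<close>

definition quantum_correlation ::
    "'h::complex_hilbert_space itself \<Rightarrow> 'v pair_pre_digraph \<Rightarrow> 'v corr \<Rightarrow> bool" where
  "quantum_correlation _ G p \<longleftrightarrow> correlation G p \<and>
     (\<exists>(\<psi>::'h) (M :: 'v \<Rightarrow> 'v \<Rightarrow> 'h \<Rightarrow> 'h) (N :: 'v \<Rightarrow> 'v \<Rightarrow> 'h \<Rightarrow> 'h).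
        norm \<psi> = 1 \<and>
        (\<forall>i\<in>pverts G. \<forall>l\<in>pverts G. positive_semidefinite (M i l) \<and> positive_semidefinite (N i l)) \<and>
        (\<forall>i\<in>pverts G. \<forall>x. (\<Sum>l\<in>pverts G. M i l x) = x \<and> (\<Sum>l\<in>pverts G. N i l x) = x) \<and>
        (\<forall>i\<in>pverts G. \<forall>l\<in>pverts G. \<forall>j\<in>pverts G. \<forall>k\<in>pverts G. M i l \<circ> N j k = N j k \<circ> M i l) \<and>
        (\<forall>l\<in>pverts G. \<forall>k\<in>pverts G. \<forall>i\<in>pverts G. \<forall>j\<in>pverts G.
           complex_of_real (p l k i j) = cinner \<psi> (M i l (N j k \<psi>))))"

definition nonlocal_symmetry ::
    "'h::complex_hilbert_space itself \<Rightarrow> 'v pair_pre_digraph \<Rightarrow> bool" where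
  "nonlocal_symmetry H G \<longleftrightarrow>
     (\<exists>p. winning G p \<and> quantum_correlation H G p \<and> \<not> winning_classical G p)"

end

theory Submission
  imports Defs
begin

text \<open>A perfect strategy makes \<open>M\<^sub>i\<^sub>l \<psi> = N\<^sub>i\<^sub>l \<psi>\<close>, so the operators \<open>M\<^sub>i\<^sub>l\<close> act on the cyclic subspace generated
  by \<open>\<psi>\<close> as a magic unitary with a tracial vector state. Only the real parts of the moments of that
  trace are needed, and everything after this step is bookkeeping with finite words in the \<open>u\<^sub>i\<^sub>l\<close>.
  Entries \<open>u\<^sub>i\<^sub>l\<close> with \<open>i\<close> and \<open>l\<close> of different degrees vanish. Hence a five-vertex graph has a fixed
  vertex, which leaves a \<open>4 \<times> 4\<close> magic unitary, or it splits into blocks of sizes 2 and 3, each of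
  which commutes, or it is regular, hence the 5-cycle or one of the two excluded graphs.

  The \<open>4 \<times> 4\<close> case is the interesting one, as \<open>C(S\<^sub>4\<^sup>+)\<close> is not commutative. There
  \<open>T(\<pi>) = Re \<tau>(u\<^bsub>1\<pi>(1)\<^esub> u\<^bsub>2\<pi>(2)\<^esub> u\<^bsub>3\<pi>(3)\<^esub>)\<close> has the required marginals but may be negative.
  The sign character is the only linear relation between the correlations \<open>p\<^sub>\<pi>\<close>, so the available freedom
  is to replace \<open>T(\<pi>)\<close> by \<open>T(\<pi>) - sgn(\<pi>) c\<close>. A suitable \<open>c\<close> exists because \<open>T(\<pi>) + T(\<sigma>) \<ge> 0\<close> for \<open>\<pi>\<close>
  even and \<open>\<sigma>\<close> odd.\<close>


section \<open>Positive operators\<close>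

lemma cinner_add_left: "cinner (x + y) z = cinner x z + cinner y z"
  for x y z :: "'h::complex_hilbert_space"
  by (metis cinner_add_right cinner_commute complex_cnj_add)

lemma cinner_scaleC_left: "cinner (c *\<^sub>C x) y = cnj c * cinner x y"
  for x y :: "'h::complex_hilbert_space"
  by (metis cinner_scaleC_right cinner_commute complex_cnj_mult)

text \<open>A real inner product for the same norm: it is symmetric, so its arguments can be
  exchanged without conjugation.\<close>

definition rinner :: "'h::complex_hilbert_space \<Rightarrow> 'h \<Rightarrow> real" where
  "rinner x y = Re (cinner x y)"

lemma rinner_commute: "rinner x y = rinner y x"
  unfolding rinner_def by (subst cinner_commute) simp

lemma rinner_add_right: "rinner x (y + z) = rinner x y + rinner x z"
  by (simp add: rinner_def cinner_add_right)

lemma rinner_scaleR_right: "rinner x (r *\<^sub>R y) = r * rinner x y"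
  by (simp add: rinner_def scaleC_of_real [symmetric] cinner_scaleC_right)

lemma rinner_zero_right [simp]: "rinner x 0 = 0"
  using rinner_scaleR_right [of x 0 0] by simp

lemma rinner_minus_right: "rinner x (- y) = - rinner x y"
  using rinner_scaleR_right [of x "-1" y] by simp

lemma rinner_diff_right: "rinner x (y - z) = rinner x y - rinner x z"
  using rinner_add_right [of x y "- z"] by (simp add: rinner_minus_right)

lemma rinner_sum_right: "rinner x (\<Sum>a\<in>S. f a) = (\<Sum>a\<in>S. rinner x (f a))"
  by (induction S rule: infinite_finite_induct) (auto simp: rinner_add_right)

lemma rinner_add_left: "rinner (y + z) x = rinner y x + rinner z x"
  by (simp add: rinner_commute [of _ x] rinner_add_right)

lemma rinner_diff_left: "rinner (y - z) x = rinner y x - rinner z x"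
  by (simp add: rinner_commute [of _ x] rinner_diff_right)

lemma rinner_scaleR_left: "rinner (r *\<^sub>R y) x = r * rinner y x"
  by (simp add: rinner_commute [of _ x] rinner_scaleR_right)

lemma rinner_sum_left: "rinner (\<Sum>a\<in>S. f a) x = (\<Sum>a\<in>S. rinner (f a) x)"
  by (simp add: rinner_commute [of _ x] rinner_sum_right)

lemma rinner_self: "rinner x x = (norm x)\<^sup>2"
  by (simp add: rinner_def norm_eq_sqrt_cinner cinner_self_ge_zero)

lemma rinner_self_le_zero: "rinner x x \<le> 0 \<longleftrightarrow> x = 0"
  by (simp add: rinner_self)

lemma psd_add: "positive_semidefinite T \<Longrightarrow> T (x + y) = T x + T y"
  by (simp add: positive_semidefinite_def bounded_clinear_def linear_simps)

lemma psd_diff: "positive_semidefinite T \<Longrightarrow> T (x - y) = T x - T y"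
  by (simp add: positive_semidefinite_def bounded_clinear_def linear_simps)

lemma psd_scaleR: "positive_semidefinite T \<Longrightarrow> T (r *\<^sub>R x) = r *\<^sub>R T x"
  by (simp add: positive_semidefinite_def bounded_clinear_def linear_simps)

lemma psd_zero: "positive_semidefinite T \<Longrightarrow> T 0 = 0"
  by (simp add: positive_semidefinite_def bounded_clinear_def linear_simps)

lemma psd_sum: "positive_semidefinite T \<Longrightarrow> T (\<Sum>a\<in>S. f a) = (\<Sum>a\<in>S. T (f a))"
  by (induction S rule: infinite_finite_induct) (auto simp: psd_zero psd_add)

lemma psd_nonneg: "positive_semidefinite T \<Longrightarrow> 0 \<le> rinner x (T x)"
  by (simp add: positive_semidefinite_def rinner_def)

text \<open>Polarisation over the complex scalars: the quadratic form is real at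
  \<open>x + \<i> *\<^sub>C y\<close>, and its imaginary part there reduces to
  \<open>Re (cinner x (T y)) - Re (cinner y (T x))\<close>.\<close>

lemma psd_symmetric:
  assumes "positive_semidefinite T"
  shows "rinner x (T y) = rinner (T x) y"
proof -
  have real: "Im (cinner z (T z)) = 0" for z
    using assms by (auto simp: positive_semidefinite_def complex_is_Real_iff)
  have scale: "T (c *\<^sub>C z) = c *\<^sub>C T z" for c z
    using assms by (simp add: positive_semidefinite_def bounded_clinear_def)
  have "Im (cinner (x + \<i> *\<^sub>C y) (T (x + \<i> *\<^sub>C y))) = 0"
    by (rule real)
  then have "Re (cinner x (T y)) = Re (cinner y (T x))"
    using real [of x] real [of y]
    by (simp add: psd_add [OF assms] scale cinner_add_left cinner_add_right
        cinner_scaleC_left cinner_scaleC_right)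
  then show ?thesis
    using rinner_commute [of y "T x"] by (simp add: rinner_def)
qed

text \<open>Once \<open>rinner x (T x) = 0\<close>, the form of \<open>T\<close> at
  \<open>T x + s *\<^sub>R x\<close> is affine in \<open>s\<close> with slope twice the squared norm
  of \<open>T x\<close>. An affine function that is bounded below has slope zero.\<close>

lemma psd_eq_zero:
  assumes T: "positive_semidefinite T" and "rinner x (T x) \<le> 0"
  shows "T x = 0"
proof -
  have q: "rinner x (T x) = 0"
    using psd_nonneg [OF T, of x] assms(2) by linarith
  define b where "b = rinner (T x) (T x)"
  define c where "c = rinner (T x) (T (T x))"
  have "0 \<le> c + 2 * s * b" for s
  proof -
    have "0 \<le> rinner (T x + s *\<^sub>R x) (T (T x + s *\<^sub>R x))"
      by (rule psd_nonneg [OF T])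
    also have "\<dots> = c + 2 * s * b + s * s * rinner x (T x)"
      by (simp add: psd_add [OF T] psd_scaleR [OF T] rinner_add_left rinner_add_right
          rinner_scaleR_left rinner_scaleR_right b_def c_def psd_symmetric [OF T, of x]
          algebra_simps)
    finally show ?thesis using q by simp
  qed
  \<comment> \<open>This value of \<open>s\<close> would make \<open>c + 2 * s * b\<close> equal to
    \<open>-1\<close>.\<close>
  from this [of "- (c + 1) / (2 * b)"] have "\<not> b > 0"
    by (auto simp: field_simps)
  then show ?thesis by (simp add: b_def rinner_self_le_zero [symmetric] not_less)
qed

text \<open>This is T^2 \<le> T for 0 \<le> T \<le> 1. The form of \<open>T\<close> at
  \<open>x - T x\<close> yields T - 2 T^2 + T^3 \<ge> 0, and the upper bound at \<open>T x\<close>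
  yields T^3 \<le> T^2.\<close>

lemma psd_norm_le:
  assumes T: "positive_semidefinite T" and le: "\<And>y. rinner y (T y) \<le> rinner y y"
  shows "rinner (T x) (T x) \<le> rinner x (T x)"
proof -
  have "0 \<le> rinner (x - T x) (T (x - T x))" by (rule psd_nonneg [OF T])
  also have "\<dots> = rinner x (T x) - 2 * rinner (T x) (T x) + rinner (T x) (T (T x))"
    by (simp add: psd_diff [OF T] rinner_diff_left rinner_diff_right psd_symmetric [OF T, of x])
  finally show ?thesis using le [of "T x"] by linarith
qed

text \<open>The equality case of \<open>psd_norm_le\<close>: the same expansion makes the form of
  \<open>T\<close> nonpositive at \<open>x - T x\<close>, so \<open>T\<close> annihilates that
  vector.\<close>

lemma psd_idem_at:
  assumes T: "positive_semidefinite T" and le: "\<And>y. rinner y (T y) \<le> rinner y y"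
    and eq: "rinner x (T x) \<le> rinner (T x) (T x)"
  shows "T (T x) = T x"
proof -
  have "rinner (x - T x) (T (x - T x))
      = rinner x (T x) - 2 * rinner (T x) (T x) + rinner (T x) (T (T x))"
    by (simp add: psd_diff [OF T] rinner_diff_left rinner_diff_right psd_symmetric [OF T, of x])
  also have "\<dots> \<le> 0" using le [of "T x"] eq by linarith
  finally have "T (x - T x) = 0" by (rule psd_eq_zero [OF T])
  then show ?thesis by (simp add: psd_diff [OF T])
qed

lemma psd_zero_map: "positive_semidefinite (\<lambda>x. 0 :: 'h::complex_hilbert_space)"
proof -
  have "c *\<^sub>C (0::'h) = 0" for c using scaleC_add_right [of c 0 0] by simp
  moreover have "cinner x (0::'h) = 0" for x using cinner_add_right [of x 0 0] by simp
  ultimately show ?thesis by (simp add: positive_semidefinite_def bounded_clinear_def)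
qed


section \<open>Tracial moments of a perfect strategy\<close>

text \<open>\<open>t\<close> stands for the function \<open>(i\<^sub>1, l\<^sub>1) \<dots> (i\<^sub>n, l\<^sub>n) \<mapsto> Re \<tau>(u\<^bsub>i\<^sub>1l\<^sub>1\<^esub> \<dots> u\<^bsub>i\<^sub>nl\<^sub>n\<^esub>)\<close> for a magic
  unitary \<open>u\<close> and a tracial state \<open>\<tau>\<close>. Taking real parts is what makes it invariant under reversal.\<close>

locale magic_trace =
  fixes V :: "'v set" and t :: "('v \<times> 'v) list \<Rightarrow> real"
  assumes finite_V: "finite V"
    and rotate: "t (x # ws) = t (ws @ [x])"
    and rev: "t (rev ws) = t ws"
    and idem: "t (x # x # ws) = t (x # ws)"
    and row_orth: "l \<noteq> k \<Longrightarrow> t ((i, l) # (i, k) # ws) = 0"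
    and col_orth: "i \<noteq> j \<Longrightarrow> t ((i, l) # (j, l) # ws) = 0"
    and row_sum: "i \<in> V \<Longrightarrow> (\<Sum>l\<in>V. t ((i, l) # ws)) = t ws"
    and col_sum: "l \<in> V \<Longrightarrow> (\<Sum>i\<in>V. t ((i, l) # ws)) = t ws"
    and square_nonneg: "0 \<le> t (rev ws @ ws)"
    and unit: "t [] = 1"

text \<open>For a magic unitary, \<open>rel_orth\<close> is the entrywise form of U A_G = A_G U: the
  product u_il u_jk vanishes when the pairs of rows and of columns are related differently.\<close>

locale graph_trace = magic_trace "pverts G" t for G :: "'v pair_pre_digraph" and t +
  assumes rel_orth: "rel G i j \<noteq> rel G l k \<Longrightarrow> t ((i, l) # (j, k) # ws) = 0"

locale perfect_strategy =
  fixes G :: "'v pair_pre_digraph" and p :: "'v corr" and \<psi> :: "'h::complex_hilbert_space"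
    and M N :: "'v \<Rightarrow> 'v \<Rightarrow> 'h \<Rightarrow> 'h"
  assumes finite_verts: "finite (pverts G)"
    and norm_state: "norm \<psi> = 1"
    and psd_M: "i \<in> pverts G \<Longrightarrow> l \<in> pverts G \<Longrightarrow> positive_semidefinite (M i l)"
    and psd_N: "i \<in> pverts G \<Longrightarrow> l \<in> pverts G \<Longrightarrow> positive_semidefinite (N i l)"
    and sum_M: "i \<in> pverts G \<Longrightarrow> (\<Sum>l\<in>pverts G. M i l x) = x"
    and sum_N: "i \<in> pverts G \<Longrightarrow> (\<Sum>l\<in>pverts G. N i l x) = x"
    and commute: "\<lbrakk>i \<in> pverts G; l \<in> pverts G; j \<in> pverts G; k \<in> pverts G\<rbrakk>
      \<Longrightarrow> M i l (N j k x) = N j k (M i l x)"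
    and corr: "\<lbrakk>i \<in> pverts G; l \<in> pverts G; j \<in> pverts G; k \<in> pverts G\<rbrakk>
      \<Longrightarrow> p l k i j = rinner \<psi> (M i l (N j k \<psi>))"
    and winning: "winning G p"
begin

section \<open>Relations of the measurements at the state vector\<close>

lemma psd_M_le:
  assumes "i \<in> pverts G" "l \<in> pverts G"
  shows "rinner y (M i l y) \<le> rinner y y"
proof -
  have "rinner y (M i l y) \<le> (\<Sum>l\<in>pverts G. rinner y (M i l y))"
    using assms by (intro member_le_sum) (auto simp: finite_verts psd_nonneg psd_M)
  also have "\<dots> = rinner y y"
    using assms by (simp add: rinner_sum_right [symmetric] sum_M)
  finally show ?thesis .
qed

lemma psd_N_le:
  assumes "i \<in> pverts G" "l \<in> pverts G"
  shows "rinner y (N i l y) \<le> rinner y y"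
proof -
  have "rinner y (N i l y) \<le> (\<Sum>l\<in>pverts G. rinner y (N i l y))"
    using assms by (intro member_le_sum) (auto simp: finite_verts psd_nonneg psd_N)
  also have "\<dots> = rinner y y"
    using assms by (simp add: rinner_sum_right [symmetric] sum_N)
  finally show ?thesis .
qed

lemma corr_rel_zero:
  assumes "i \<in> pverts G" "l \<in> pverts G" "j \<in> pverts G" "k \<in> pverts G" "rel G i j \<noteq> rel G l k"
  shows "rinner \<psi> (M i l (N j k \<psi>)) = 0"
  using winning assms by (simp add: winning_def corr [symmetric])

text \<open>Insert the sum of the \<open>N i k\<close> over \<open>k\<close>. Equal questions must
  receive equal answers, so only \<open>k = l\<close> survives. \<open>N_state_inner\<close> does
  the same with the roles exchanged.\<close>

lemma M_state_inner:
  assumes "i \<in> pverts G" "l \<in> pverts G"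
  shows "rinner \<psi> (M i l \<psi>) = rinner \<psi> (M i l (N i l \<psi>))"
proof -
  have "M i l \<psi> = (\<Sum>k\<in>pverts G. M i l (N i k \<psi>))"
    using assms by (simp add: psd_sum [OF psd_M, symmetric] sum_N)
  then have "rinner \<psi> (M i l \<psi>) = (\<Sum>k\<in>pverts G. rinner \<psi> (M i l (N i k \<psi>)))"
    by (simp add: rinner_sum_right)
  also have "\<dots> = (\<Sum>k\<in>{l}. rinner \<psi> (M i l (N i k \<psi>)))"
    using assms finite_verts
    by (intro sum.mono_neutral_right) (auto intro!: corr_rel_zero simp: rel_def split: if_splits)
  finally show ?thesis by simp
qed

lemma N_state_inner:
  assumes "i \<in> pverts G" "l \<in> pverts G"
  shows "rinner \<psi> (N i l \<psi>) = rinner \<psi> (M i l (N i l \<psi>))"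
proof -
  have "rinner \<psi> (N i l \<psi>) = (\<Sum>k\<in>pverts G. rinner \<psi> (M i k (N i l \<psi>)))"
    using assms by (simp add: rinner_sum_right [symmetric] sum_M)
  also have "\<dots> = (\<Sum>k\<in>{l}. rinner \<psi> (M i k (N i l \<psi>)))"
    using assms finite_verts
    by (intro sum.mono_neutral_right) (auto intro!: corr_rel_zero simp: rel_def split: if_splits)
  finally show ?thesis by simp
qed

text \<open>Expand the squared distance of the two vectors. Each squared norm is at most
  \<open>rinner \<psi> (M i l (N i l \<psi>))\<close> by \<open>psd_norm_le\<close>, and the cross
  term is exactly minus twice that number.\<close>

lemma M_eq_N:
  assumes "i \<in> pverts G" "l \<in> pverts G"
  shows "M i l \<psi> = N i l \<psi>"
proof -
  have "rinner (M i l \<psi> - N i l \<psi>) (M i l \<psi> - N i l \<psi>)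
      = rinner (M i l \<psi>) (M i l \<psi>) + rinner (N i l \<psi>) (N i l \<psi>) - 2 * rinner (M i l \<psi>) (N i l \<psi>)"
    by (simp add: rinner_diff_left rinner_diff_right rinner_commute [of "N i l \<psi>" "M i l \<psi>"])
  also have "rinner (M i l \<psi>) (N i l \<psi>) = rinner \<psi> (M i l (N i l \<psi>))"
    using assms by (simp add: psd_symmetric [OF psd_M])
  finally have "rinner (M i l \<psi> - N i l \<psi>) (M i l \<psi> - N i l \<psi>) \<le> 0"
    using psd_norm_le [OF psd_M psd_M_le, OF assms assms, of \<psi>]
      psd_norm_le [OF psd_N psd_N_le, OF assms assms, of \<psi>]
      M_state_inner [OF assms] N_state_inner [OF assms] by linarith
  then show ?thesis by (simp add: rinner_self_le_zero)
qed

text \<open>Replacing \<open>N i l \<psi>\<close> by \<open>M i l \<psi>\<close> in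
  \<open>M_state_inner\<close> gives equality in \<open>psd_norm_le\<close>, so
  \<open>psd_idem_at\<close> applies.\<close>

lemma M_idem_state:
  assumes "i \<in> pverts G" "l \<in> pverts G"
  shows "M i l (M i l \<psi>) = M i l \<psi>"
proof (rule psd_idem_at [OF psd_M psd_M_le, OF assms assms])
  show "rinner \<psi> (M i l \<psi>) \<le> rinner (M i l \<psi>) (M i l \<psi>)"
    using M_state_inner [OF assms] assms
    by (simp add: M_eq_N [symmetric] psd_symmetric [OF psd_M])
qed

text \<open>With \<open>M j k \<psi> = N j k \<psi>\<close>, the form of \<open>M i l\<close> at
  this vector collapses to a value of the correlation, which is zero by the winning condition.
  Positivity of \<open>M i l\<close> then kills the vector itself.\<close>

lemma M_orth_state:
  assumes V: "i \<in> pverts G" "l \<in> pverts G" "j \<in> pverts G" "k \<in> pverts G"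
    and "rel G i j \<noteq> rel G l k"
  shows "M i l (M j k \<psi>) = 0"
proof -
  have "rinner (N j k \<psi>) (M i l (N j k \<psi>)) = rinner \<psi> (M i l (N j k (N j k \<psi>)))"
    using V by (simp add: psd_symmetric [OF psd_N, symmetric] commute)
  also have "N j k (N j k \<psi>) = N j k \<psi>"
    using V by (metis M_eq_N M_idem_state commute)
  also have "rinner \<psi> (M i l (N j k \<psi>)) = 0"
    by (rule corr_rel_zero) fact+
  finally show ?thesis
    using V psd_eq_zero [OF psd_M, of i l "N j k \<psi>"] by (simp add: M_eq_N)
qed

text \<open>Only row sums are assumed. The column sums \<open>X l\<close> satisfy |X_l - \<psi>|^2 =
  1 - <\<psi>, X_l>. Summed over all columns the right-hand side is zero, because the rows sum to
  the identity, so each nonnegative term is zero.\<close>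

lemma M_col_sum_state:
  assumes "l \<in> pverts G"
  shows "(\<Sum>i\<in>pverts G. M i l \<psi>) = \<psi>"
proof -
  let ?V = "pverts G"
  define X where "X l = (\<Sum>i\<in>?V. M i l \<psi>)" for l
  have state: "rinner \<psi> \<psi> = 1" by (simp add: rinner_self norm_state)
  have XX: "rinner (X l) (X l) = rinner \<psi> (X l)" if l: "l \<in> ?V" for l
  proof -
    have "rinner (X l) (X l) = (\<Sum>i\<in>?V. \<Sum>j\<in>?V. rinner (M j l \<psi>) (M i l \<psi>))"
      by (simp add: X_def rinner_sum_left rinner_sum_right)
    also have "\<dots> = (\<Sum>i\<in>?V. rinner \<psi> (M i l \<psi>))"
    proof (rule sum.cong [OF refl])
      fix i assume i: "i \<in> ?V"
      have "(\<Sum>j\<in>?V. rinner (M j l \<psi>) (M i l \<psi>)) = (\<Sum>j\<in>{i}. rinner (M j l \<psi>) (M i l \<psi>))"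
        using l i finite_verts
        by (intro sum.mono_neutral_right)
          (auto simp: psd_symmetric [OF psd_M, symmetric] M_orth_state rel_def)
      then show "(\<Sum>j\<in>?V. rinner (M j l \<psi>) (M i l \<psi>)) = rinner \<psi> (M i l \<psi>)"
        using l i by (simp add: psd_symmetric [OF psd_M, symmetric] M_idem_state)
    qed
    finally show ?thesis by (simp add: X_def rinner_sum_right)
  qed
  have dist: "rinner (X l - \<psi>) (X l - \<psi>) = 1 - rinner \<psi> (X l)" if "l \<in> ?V" for l
    by (simp add: rinner_diff_left rinner_diff_right XX [OF that] state rinner_commute [of "X l" \<psi>])
  have "(\<Sum>l\<in>?V. X l) = (\<Sum>i\<in>?V. \<psi>)"
    unfolding X_def by (subst sum.swap) (simp add: sum_M cong: sum.cong)
  then have "rinner \<psi> (\<Sum>l\<in>?V. X l) = rinner \<psi> (\<Sum>i\<in>?V. \<psi>)"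
    by simp
  then have "(\<Sum>l\<in>?V. rinner \<psi> (X l)) = real (card ?V)"
    by (simp add: rinner_sum_right state)
  then have "(\<Sum>l\<in>?V. rinner (X l - \<psi>) (X l - \<psi>)) = 0"
    by (simp add: dist sum_subtractf)
  then have "rinner (X l - \<psi>) (X l - \<psi>) = 0"
    using assms finite_verts by (subst (asm) sum_nonneg_eq_0_iff) (auto simp: rinner_self)
  then show ?thesis using rinner_self_le_zero [of "X l - \<psi>"] by (simp add: X_def)
qed

text \<open>Extending the measurements by zero makes the identities below hold for arbitrary words.\<close>

definition A :: "'v \<times> 'v \<Rightarrow> 'h \<Rightarrow> 'h" where
  "A x = (if x \<in> pverts G \<times> pverts G then M (fst x) (snd x) else (\<lambda>_. 0))"

definition B :: "'v \<times> 'v \<Rightarrow> 'h \<Rightarrow> 'h" where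
  "B x = (if x \<in> pverts G \<times> pverts G then N (fst x) (snd x) else (\<lambda>_. 0))"

definition moment :: "('v \<times> 'v) list \<Rightarrow> real" where
  "moment ws = rinner \<psi> (foldr A ws \<psi>)"

section \<open>Words in the measurements and their moments\<close>

lemma psd_A: "positive_semidefinite (A x)" and psd_B: "positive_semidefinite (B x)"
  by (auto simp: A_def B_def psd_M psd_N psd_zero_map)

lemma A_commute: "A x (B y z) = B y (A x z)"
  by (auto simp: A_def B_def commute psd_zero [OF psd_M] psd_zero [OF psd_N])

lemma A_eq_B: "A x \<psi> = B x \<psi>"
  by (auto simp: A_def B_def M_eq_N)

lemma foldr_A_commute: "foldr A ws (B y z) = B y (foldr A ws z)"
  by (induction ws) (auto simp: A_commute)

text \<open>The last letter acts on \<open>\<psi>\<close> first, where it can be traded for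
  \<open>B x\<close>, which commutes with the rest of the word. By induction every word vector
  arises from \<open>\<psi>\<close> by operators commuting with all \<open>A y\<close>, so relations
  known at \<open>\<psi>\<close> hold at all word vectors.\<close>

lemma foldr_A_snoc: "foldr A (ws @ [x]) \<psi> = B x (foldr A ws \<psi>)"
  by (simp add: A_eq_B foldr_A_commute)

lemma A_idem: "A x (A x (foldr A ws \<psi>)) = A x (foldr A ws \<psi>)"
proof (induction ws rule: rev_induct)
  case Nil
  show ?case by (auto simp: A_def M_idem_state)
next
  case (snoc y ws)
  then show ?case by (simp only: foldr_A_snoc A_commute)
qed

lemma A_orth:
  assumes "rel G i j \<noteq> rel G l k"
  shows "A (i, l) (A (j, k) (foldr A ws \<psi>)) = 0"
proof (induction ws rule: rev_induct)
  case Nil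
  show ?case using assms by (auto simp: A_def M_orth_state psd_zero [OF psd_M])
next
  case (snoc y ws)
  then show ?case by (simp only: foldr_A_snoc A_commute psd_zero [OF psd_B])
qed

lemma A_row_sum: "i \<in> pverts G \<Longrightarrow> (\<Sum>l\<in>pverts G. A (i, l) x) = x"
  by (simp add: A_def sum_M cong: sum.cong)

lemma A_col_sum: "l \<in> pverts G \<Longrightarrow> (\<Sum>i\<in>pverts G. A (i, l) (foldr A ws \<psi>)) = foldr A ws \<psi>"
proof (induction ws rule: rev_induct)
  case Nil
  then show ?case by (simp add: A_def M_col_sum_state cong: sum.cong)
next
  case (snoc y ws)
  then show ?case by (simp only: foldr_A_snoc A_commute psd_sum [OF psd_B, symmetric])
qed

lemma rinner_foldr: "rinner x (foldr A ws y) = rinner (foldr A (rev ws) x) y"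
  by (induction ws arbitrary: x) (auto simp: psd_symmetric [OF psd_A])

lemma moment_trace: "graph_trace G moment"
proof
  show "finite (pverts G)" by (rule finite_verts)
  \<comment> \<open>The source of traciality: move \<open>A x\<close> to the left argument, replace
    it by \<open>B x\<close> on \<open>\<psi>\<close>, move it back, and absorb it at the end of the
    word.\<close>
  show "moment (x # ws) = moment (ws @ [x])" for x ws
    by (simp add: moment_def foldr_A_snoc psd_symmetric [OF psd_A] psd_symmetric [OF psd_B]
        A_eq_B del: foldr_append)
  show "moment (rev ws) = moment ws" for ws
    by (simp add: moment_def rinner_foldr [of _ "rev ws"] rinner_commute)
  show "moment (x # x # ws) = moment (x # ws)" for x ws
    by (simp add: moment_def A_idem)
  show orth: "moment ((i, l) # (j, k) # ws) = 0" if "rel G i j \<noteq> rel G l k" for i j l k ws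
    using that by (simp add: moment_def A_orth)
  show "moment ((i, l) # (i, k) # ws) = 0" if "l \<noteq> k" for i l k ws
    using that by (intro orth) (simp add: rel_def)
  show "moment ((i, l) # (j, l) # ws) = 0" if "i \<noteq> j" for i j l ws
    using that by (intro orth) (simp add: rel_def)
  show "(\<Sum>l\<in>pverts G. moment ((i, l) # ws)) = moment ws" if "i \<in> pverts G" for i ws
    using that by (simp add: moment_def rinner_sum_right [symmetric] A_row_sum)
  show "(\<Sum>i\<in>pverts G. moment ((i, l) # ws)) = moment ws" if "l \<in> pverts G" for l ws
    using that by (simp add: moment_def rinner_sum_right [symmetric] A_col_sum)
  show "0 \<le> moment (rev ws @ ws)" for ws
    by (simp add: moment_def rinner_foldr [of \<psi> "rev ws"] rinner_self)
  show "moment [] = 1"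
    by (simp add: moment_def rinner_self norm_state)
qed

lemma corr_eq_moment:
  assumes "i \<in> pverts G" "l \<in> pverts G" "j \<in> pverts G" "k \<in> pverts G"
  shows "p l k i j = moment [(i, l), (j, k)]"
  using assms by (simp add: corr moment_def A_def M_eq_N)

end


section \<open>Permutations\<close>

text \<open>The permutation \<open>inv \<pi> \<circ> \<sigma>\<close> is supported on two points,
  hence is the identity or their transposition.\<close>

lemma permutes_agree_except:
  assumes \<pi>: "\<pi> permutes V" and \<sigma>: "\<sigma> permutes V" and "m \<noteq> n"
    and agree: "\<And>x. x \<in> V - {m, n} \<Longrightarrow> \<sigma> x = \<pi> x"
  shows "\<sigma> = \<pi> \<or> \<sigma> = \<pi> \<circ> Transposition.transpose m n"
proof -
  have agree': "\<sigma> x = \<pi> x" if "x \<noteq> m" "x \<noteq> n" for x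
    using that agree [of x] \<pi> \<sigma> by (cases "x \<in> V") (auto simp: permutes_not_in)
  define \<rho> where "\<rho> = inv \<pi> \<circ> \<sigma>"
  have inv: "inv \<pi> (\<pi> x) = x" "\<pi> (inv \<pi> x) = x" for x
    using permutes_inverses [OF \<pi>] by auto
  have "\<rho> permutes V" unfolding \<rho>_def
    by (intro permutes_compose permutes_inv \<pi> \<sigma>)
  moreover have fix_: "\<rho> x = x" if "x \<noteq> m" "x \<noteq> n" for x
    using that by (simp add: \<rho>_def agree' inv)
  ultimately have "\<rho> permutes {m, n}"
    by (auto intro: permutes_superset)
  then have "\<rho> = id \<or> \<rho> = Transposition.transpose m n"
    by (simp add: permutes_doubleton_iff)
  moreover have "\<sigma> = \<pi> \<circ> \<rho>" by (auto simp: \<rho>_def inv)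
  ultimately show ?thesis by auto
qed

text \<open>The odd elements of S_4 are the transpositions and the 4-cycles. The proof splits on the
  existence of a fixed point; 3-cycles and double transpositions are excluded as products of two
  transpositions.\<close>

lemma odd_permutation_of_four:
  assumes \<rho>: "\<rho> permutes V" and card: "card V = 4" and odd: "\<not> evenperm \<rho>"
  obtains m n where "m \<in> V" "n \<in> V" "m \<noteq> n" "\<rho> = Transposition.transpose m n"
  | a b c d where "distinct [a, b, c, d]" "V = {a, b, c, d}" "\<rho> a = b" "\<rho> b = c" "\<rho> c = d"
proof -
  note transposition = that(1) and four_cycle = that(2)
  have finite: "finite V" using card by (metis card.infinite zero_neq_numeral)
  have inj: "\<rho> x = \<rho> y \<longleftrightarrow> x = y" for x y
    using permutes_inj [OF \<rho>] by (auto dest: injD)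
  have mem: "\<rho> x \<in> V \<longleftrightarrow> x \<in> V" for x using \<rho> by (rule permutes_in_image)
  have outside: "\<rho> x = x" if "x \<notin> V" for x using \<rho> that by (rule permutes_not_in)
  have two: thesis if "m \<in> V" "n \<in> V" "m \<noteq> n" "\<And>x. x \<in> V - {m, n} \<Longrightarrow> \<rho> x = x" for m n
  proof -
    have "\<rho> = id \<or> \<rho> = id \<circ> Transposition.transpose m n"
      using that by (intro permutes_agree_except [OF permutes_id \<rho>]) auto
    then have "\<rho> = Transposition.transpose m n" using odd by auto
    with that(1-3) show thesis by (rule transposition)
  qed
  have not_even: False if "\<rho> = Transposition.transpose u v \<circ> Transposition.transpose x y" "u \<noteq> v" "x \<noteq> y" for u v x y
    using odd that by (simp add: evenperm_comp evenperm_swap permutation_swap_id)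
  \<comment> \<open>With \<open>x\<close> fixed and \<open>u\<close> sent to \<open>v\<close>, a
    3-cycle would be even, so \<open>u\<close> and \<open>v\<close> are interchanged.\<close>
  have three: thesis if V: "V = {x, u, v, w}" "distinct [x, u, v, w]" and "\<rho> x = x" "\<rho> u = v"
    for x u v w
  proof -
    have "\<rho> v \<in> {u, w}" using mem [of v] inj [of v x] inj [of v u] that by auto
    moreover have "\<rho> v \<noteq> w"
    proof
      assume vw: "\<rho> v = w"
      then have "\<rho> w = u"
        using mem [of w] inj [of w x] inj [of w u] inj [of w v] that by auto
      have "\<rho> z = (Transposition.transpose u v \<circ> Transposition.transpose v w) z" for z
      proof (cases "z \<in> V")
        case True
        then consider "z = x" | "z = u" | "z = v" | "z = w" using V by blast
        then show ?thesis
          by cases (use V(2) that(3,4) vw \<open>\<rho> w = u\<close> in \<open>auto simp: Transposition.transpose_def\<close>)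
      next
        case False
        then show ?thesis using V(1) outside [OF False] by (simp add: Transposition.transpose_def)
      qed
      then have "\<rho> = Transposition.transpose u v \<circ> Transposition.transpose v w" by (rule ext)
      then show False by (rule not_even) (use V(2) in auto)
    qed
    ultimately have vu: "\<rho> v = u" by simp
    then have "\<rho> w = w"
      using mem [of w] inj [of w x] inj [of w u] inj [of w v] that by auto
    with that vu show thesis by (intro two [of u v]) auto
  qed
  have extend: "\<exists>y. y \<in> V \<and> y \<notin> S" if "finite S" "card S < 4" for S
    using card_mono [of S V] that card by fastforce
  show thesis
  proof (cases "\<exists>x\<in>V. \<rho> x = x")
    case True
    then obtain x where x: "x \<in> V" "\<rho> x = x" by blast
    have "card (V - {x}) = 3" using x card finite by simp
    then obtain u v w where uvw: "V - {x} = {u, v, w}" "distinct [u, v, w]"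
      by (auto simp: card_3_iff)
    then have V: "V = {x, u, v, w}" "distinct [x, u, v, w]" using x by auto
    have "\<rho> u \<in> {u, v, w}" using mem [of u] inj [of u x] V x by auto
    then show thesis
    proof (elim insertE emptyE)
      assume "\<rho> u = u"
      with V x show thesis by (intro two [of v w]) auto
    next
      assume "\<rho> u = v"
      with V x show thesis by (intro three [of x u v w])
    next
      assume "\<rho> u = w"
      with V x show thesis by (intro three [of x u w v]) auto
    qed
  next
    case False
    then have no_fix: "x \<in> V \<Longrightarrow> \<rho> x \<noteq> x" for x by auto
    have "card V \<noteq> 0" using card by simp
    then obtain a where a: "a \<in> V" by (metis card.empty ex_in_conv)
    define b where "b = \<rho> a"
    define c where "c = \<rho> b"
    have b: "b \<in> V" "b \<noteq> a" and c: "c \<in> V" "c \<noteq> b"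
      using a no_fix mem by (auto simp: b_def c_def)
    show thesis
    proof (cases "c = a")
      case True
      have "card (V - {a, b}) = 2" using a b card finite by simp
      then obtain m n where mn: "V - {a, b} = {m, n}" "m \<noteq> n" by (auto simp: card_2_iff)
      then have V: "V = {a, b, m, n}" "distinct [a, b, m, n]" using a b by auto
      have "\<rho> m = n"
        using mem [of m] no_fix [of m] inj [of m a] inj [of m b] V True by (auto simp: b_def c_def)
      moreover have "\<rho> n = m"
        using mem [of n] no_fix [of n] inj [of n a] inj [of n b] V True by (auto simp: b_def c_def)
      ultimately have mn: "\<rho> m = n" "\<rho> n = m" by auto
      have "\<rho> z = (Transposition.transpose a b \<circ> Transposition.transpose m n) z" for z
      proof (cases "z \<in> V")
        case True
        then consider "z = a" | "z = b" | "z = m" | "z = n" using V by blast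
        then show ?thesis
          by cases (use V(2) \<open>c = a\<close> b_def c_def mn in
              \<open>auto simp: Transposition.transpose_def\<close>)
      next
        case False
        then show ?thesis using V(1) outside [OF False] by (simp add: Transposition.transpose_def)
      qed
      then have "\<rho> = Transposition.transpose a b \<circ> Transposition.transpose m n" by (rule ext)
      then have False by (rule not_even) (use V(2) in auto)
      then show thesis ..
    next
      case False
      obtain d where d: "d \<in> V" "d \<notin> {a, b, c}" using extend [of "{a, b, c}"] b c False
        by auto
      have dist: "distinct [a, b, c, d]" using a b c d False by auto
      then have V: "V = {a, b, c, d}"
        using a b c d card finite by (intro card_seteq [symmetric]) auto
      have "\<rho> c = d"
      \<comment> \<open>Otherwise \<open>a\<close>, \<open>b\<close>, \<open>c\<close> form a
        3-cycle and \<open>d\<close> is fixed.\<close>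
      proof (rule ccontr)
        assume "\<rho> c \<noteq> d"
        then have "\<rho> c = a"
          using mem [of c] no_fix [of c] inj [of c a] V dist by (auto simp: b_def)
        then have "\<rho> d = d"
          using mem [of d] inj [of d a] inj [of d b] inj [of d c] V dist
          by (auto simp: b_def c_def)
        then show False using no_fix d by auto
      qed
      then show thesis using dist V by (intro four_cycle [of a b c d]) (auto simp: b_def c_def)
    qed
  qed
qed

lemma exists_permutes_two:
  assumes "i \<in> V" "j \<in> V" "l \<in> V" "k \<in> V" "i \<noteq> j" "l \<noteq> k"
  obtains \<pi> where "\<pi> permutes V" "\<pi> i = l" "\<pi> j = k"
proof
  \<comment> \<open>\<open>?x\<close> is where the first transposition sends \<open>j\<close>. The
    second one takes it to \<open>k\<close> without moving \<open>l\<close>.\<close>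
  let ?x = "Transposition.transpose i l j"
  show "Transposition.transpose ?x k \<circ> Transposition.transpose i l permutes V"
    using assms by (intro permutes_compose permutes_swap_id) (auto simp: Transposition.transpose_def)
  show "(Transposition.transpose ?x k \<circ> Transposition.transpose i l) i = l" "(Transposition.transpose ?x k \<circ> Transposition.transpose i l) j = k"
    using assms by (auto simp: Transposition.transpose_def)
qed

lemma card_eq_fourE:
  assumes "card V = 4"
  obtains a b c d where "distinct [a, b, c, d]" "V = {a, b, c, d}"
proof -
  have "finite V" using assms by (metis card.infinite zero_neq_numeral)
  then obtain xs where xs: "set xs = V" "distinct xs" using finite_distinct_list by auto
  then have "length xs = 4" using assms distinct_card by fastforce
  then obtain a b c d where "xs = [a, b, c, d]"
    by (auto simp: numeral_eq_Suc length_Suc_conv)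
  with xs show thesis by (intro that [of a b c d]) auto
qed

text \<open>Used for marginals that prescribe a permutation off two points: the marginal sum then
  has exactly two terms, which differ by a transposition.\<close>

lemma permutes_eqI_two:
  assumes \<pi>: "\<pi> permutes V" and mn: "m \<in> V" "n \<in> V" "m \<noteq> n"
    and P: "\<And>\<rho>. \<rho> permutes V \<Longrightarrow> P \<rho> \<longleftrightarrow> (\<forall>x\<in>V - {m, n}. \<rho> x = \<pi> x)"
  shows "{\<rho>. \<rho> permutes V \<and> P \<rho>} = {\<pi>, \<pi> \<circ> Transposition.transpose m n}"
    and "\<pi> \<noteq> \<pi> \<circ> Transposition.transpose m n"
proof -
  let ?\<pi>' = "\<pi> \<circ> Transposition.transpose m n"
  have \<pi>': "?\<pi>' permutes V"
    by (intro permutes_compose permutes_swap_id \<pi> mn)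
  have "?\<pi>' x = \<pi> x" if "x \<in> V - {m, n}" for x
    using that by (auto simp: Transposition.transpose_def)
  then show "{\<rho>. \<rho> permutes V \<and> P \<rho>} = {\<pi>, ?\<pi>'}"
  proof (intro equalityI subsetI)
    fix \<rho> assume "\<rho> \<in> {\<rho>. \<rho> permutes V \<and> P \<rho>}"
    then have "\<rho> permutes V" "\<And>x. x \<in> V - {m, n} \<Longrightarrow> \<rho> x = \<pi> x"
      using P by blast+
    from permutes_agree_except [OF \<pi> this(1) mn(3) this(2)]
    show "\<rho> \<in> {\<pi>, ?\<pi>'}" by simp
  qed (use \<pi> \<pi>' P in auto)
  have "?\<pi>' m \<noteq> \<pi> m"
    using mn permutes_inj [OF \<pi>] by (auto dest: injD)
  then show "\<pi> \<noteq> ?\<pi>'" by metis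
qed


section \<open>Decomposition into permutations\<close>

context magic_trace
begin

text \<open>A nonnegative weight on permutations with the two-point marginals of \<open>t\<close>.
  Support on automorphisms and total mass one are recovered from the marginals in
  \<open>winning_classicalI\<close>.\<close>

definition decomposable :: bool where
  "decomposable \<longleftrightarrow> (\<exists>w. (\<forall>\<pi>. 0 \<le> w \<pi>) \<and> (\<forall>i\<in>V. \<forall>j\<in>V. \<forall>l\<in>V. \<forall>k\<in>V.
     t [(i, l), (j, k)] = (\<Sum>\<pi> | \<pi> permutes V \<and> \<pi> i = l \<and> \<pi> j = k. w \<pi>)))"

section \<open>Symmetry and positivity of short words\<close>

lemma swap2: "t [x, y] = t [y, x]"
  using rotate [of x "[y]"] by simp

lemma rotate3: "t [x, y, z] = t [y, z, x]"
  using rotate [of x "[y, z]"] by simp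

text \<open>Reversal composed with a rotation is a transposition of three letters, so three-letter
  moments are symmetric under all reorderings although the letters need not commute.\<close>

lemma swap3: "t [x, y, z] = t [y, x, z]"
  using rev [of "[x, y, z]"] rotate3 [of y x z] rotate3 [of x z y] by simp

lemma swap3': "t [x, y, z] = t [x, z, y]"
  using swap3 [of x y z] rotate3 [of y x z] by simp

lemma rotate4: "t [x, y, z, u] = t [y, z, u, x]"
  using rotate [of x "[y, z, u]"] by simp

text \<open>The first and last letters of a word are cyclic neighbours, so their orthogonality also
  makes the moment vanish.\<close>

lemma ends3: "l \<noteq> k \<Longrightarrow> t [(i, l), y, (i, k)] = 0" "i \<noteq> j \<Longrightarrow> t [(i, l), y, (j, l)] = 0"
  using rotate [of "(i, k)" "[(i, l), y]"] rotate [of "(j, l)" "[(i, l), y]"]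
  by (simp_all add: row_orth col_orth)

lemma ends4: "l \<noteq> k \<Longrightarrow> t [(i, l), y, z, (i, k)] = 0" "i \<noteq> j \<Longrightarrow> t [(i, l), y, z, (j, l)] = 0"
  using rotate [of "(i, k)" "[(i, l), y, z]"] rotate [of "(j, l)" "[(i, l), y, z]"]
  by (simp_all add: row_orth col_orth)

text \<open>By rotation and idempotency this moment is the squared length of the word
  \<open>[x, y, z]\<close>.\<close>

lemma sandwich_nonneg: "0 \<le> t [y, x, y, z]"
proof -
  have "t [z, y, x, x, y, z] = t [z, z, y, x, x, y]" using rotate [of z "[z, y, x, x, y]"] by simp
  also have "\<dots> = t [z, y, x, x, y]" by (rule idem)
  also have "\<dots> = t [y, x, x, y, z]" using rotate [of z "[y, x, x, y]"] by simp
  also have "\<dots> = t [x, x, y, z, y]" using rotate [of y "[x, x, y, z]"] by simp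
  also have "\<dots> = t [x, y, z, y]" by (rule idem)
  also have "\<dots> = t [y, x, y, z]" using rotate [of y "[x, y, z]"] by simp
  finally show ?thesis using square_nonneg [of "[x, y, z]"] by simp
qed

lemma pair_nonneg: "0 \<le> t [x, y]"
proof -
  have "t [y, x, x, y] = t [y, y, x, x]" using rotate [of y "[y, x, x]"] by simp
  also have "\<dots> = t [y, x, x]" by (rule idem)
  also have "\<dots> = t [x, x, y]" using rotate [of y "[x, x]"] by simp
  also have "\<dots> = t [x, y]" by (rule idem)
  finally show ?thesis using square_nonneg [of "[x, y]"] by simp
qed

text \<open>If exactly one of \<open>i = j\<close> and \<open>l = k\<close> holds, both sides
  vanish. If both hold, the one-letter moment is split over the image of a second vertex
  \<open>m\<close>, which exists since \<open>V\<close> has at least two elements.\<close>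

lemma decomposableI:
  assumes card: "card V \<ge> 2" and nonneg: "\<And>\<pi>. 0 \<le> w \<pi>"
    and pairs: "\<And>i j l k. \<lbrakk>i \<in> V; j \<in> V; l \<in> V; k \<in> V; i \<noteq> j; l \<noteq> k\<rbrakk>
      \<Longrightarrow> t [(i, l), (j, k)] = (\<Sum>\<pi> | \<pi> permutes V \<and> \<pi> i = l \<and> \<pi> j = k. w \<pi>)"
  shows decomposable
proof -
  have inj: "\<pi> i = \<pi> j \<longleftrightarrow> i = j" if "\<pi> permutes V" for \<pi> i j
    using permutes_inj [OF that] by (auto dest: injD)
  have distinct_rows: "t [(i, l), (j, k)] = (\<Sum>\<pi> | \<pi> permutes V \<and> \<pi> i = l \<and> \<pi> j = k. w \<pi>)"
    if "i \<in> V" "j \<in> V" "l \<in> V" "k \<in> V" "i \<noteq> j" for i j l k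
  proof (cases "l = k")
    case True
    then have empty: "{\<pi>. \<pi> permutes V \<and> \<pi> i = l \<and> \<pi> j = k} = {}"
      using \<open>i \<noteq> j\<close> inj by (metis (mono_tags, lifting) empty_Collect_eq)
    show ?thesis unfolding empty using True \<open>i \<noteq> j\<close> by (simp add: col_orth)
  qed (use that pairs in auto)
  have "t [(i, l), (j, k)] = (\<Sum>\<pi> | \<pi> permutes V \<and> \<pi> i = l \<and> \<pi> j = k. w \<pi>)"
    if V: "i \<in> V" "j \<in> V" "l \<in> V" "k \<in> V" for i j l k
  proof (cases "i = j")
    case True
    show ?thesis
    proof (cases "l = k")
      case False
      with True have empty: "{\<pi>. \<pi> permutes V \<and> \<pi> i = l \<and> \<pi> j = k} = {}" by auto
      show ?thesis unfolding empty using True False by (simp add: row_orth)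
    next
      case eq: True
      have "\<not> V \<subseteq> {i}" using card card_mono [of "{i}" V] by auto
      then obtain m where m: "m \<in> V" "m \<noteq> i" by auto
      have fin: "finite {\<pi>. \<pi> permutes V \<and> \<pi> i = l}"
        using finite_permutations [OF finite_V] by (rule rev_finite_subset) auto
      have "t [(i, l), (j, k)] = t [(i, l)]" using True eq by (simp add: idem)
      also have "\<dots> = (\<Sum>q\<in>V. t [(m, q), (i, l)])" using m by (simp add: row_sum)
      also have "\<dots> = (\<Sum>q\<in>V. \<Sum>\<pi> | \<pi> permutes V \<and> \<pi> i = l \<and> \<pi> m = q. w \<pi>)"
        using V m by (intro sum.cong refl) (simp add: swap2 [of "(m, _)"] distinct_rows)
      also have "\<dots> = (\<Sum>q\<in>V. \<Sum>\<pi>\<in>{\<pi> \<in> {\<pi>. \<pi> permutes V \<and> \<pi> i = l}. \<pi> m = q}. w \<pi>)"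
        by (intro sum.cong) auto
      also have "\<dots> = (\<Sum>\<pi> | \<pi> permutes V \<and> \<pi> i = l. w \<pi>)"
        using m by (intro sum.group fin finite_V) (auto simp: permutes_in_image)
      finally show ?thesis using True eq by simp
    qed
  qed (use V distinct_rows in auto)
  with nonneg show ?thesis unfolding decomposable_def by blast
qed

section \<open>The 4 x 4 magic unitary\<close>

lemma row_sum4:
  "\<lbrakk>distinct [a, b, c, d]; V = {a, b, c, d}; i \<in> V\<rbrakk>
    \<Longrightarrow> t ((i, a) # ws) + t ((i, b) # ws) + t ((i, c) # ws) + t ((i, d) # ws) = t ws"
  using row_sum [of i ws] by simp

lemma col_sum4:
  "\<lbrakk>distinct [a, b, c, d]; V = {a, b, c, d}; l \<in> V\<rbrakk>
    \<Longrightarrow> t ((a, l) # ws) + t ((b, l) # ws) + t ((c, l) # ws) + t ((d, l) # ws) = t ws"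
  using col_sum [of l ws] by simp

text \<open>Inserting the sum over row \<open>r2\<close> and the sum over column \<open>c3\<close>
  leaves two terms each, and the two sums share the term containing \<open>(r2, c3)\<close>.\<close>

lemma third_index:
  assumes r: "distinct [r0, r1, r2, r3]" "V = {r0, r1, r2, r3}"
    and c: "distinct [c0, c1, c2, c3]" "V = {c0, c1, c2, c3}"
  shows "t [(r0, c0), (r1, c1), (r2, c2)] = t [(r0, c0), (r1, c1), (r3, c3)]"
proof -
  have ne: "r0 \<noteq> r1" "r0 \<noteq> r2" "r0 \<noteq> r3" "r1 \<noteq> r2" "r1 \<noteq> r3" "r2 \<noteq> r3"
    "c0 \<noteq> c1" "c0 \<noteq> c2" "c0 \<noteq> c3" "c1 \<noteq> c2" "c1 \<noteq> c3" "c2 \<noteq> c3"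
    using r(1) c(1) by auto
  note [simp] = ne ne [symmetric]
  have V: "r0 \<in> V" "r1 \<in> V" "r2 \<in> V" "r3 \<in> V" "c3 \<in> V" using r(2) c(2) by auto
  have "t [(r2, c2), (r0, c0), (r1, c1)] + t [(r2, c3), (r0, c0), (r1, c1)] = t [(r0, c0), (r1, c1)]"
    using row_sum4 [OF c V(3), of "[(r0, c0), (r1, c1)]"] by (simp add: col_orth ends3)
  moreover have "t [(r2, c3), (r0, c0), (r1, c1)] + t [(r3, c3), (r0, c0), (r1, c1)]
      = t [(r0, c0), (r1, c1)]"
    using col_sum4 [OF r V(5), of "[(r0, c0), (r1, c1)]"] by (simp add: row_orth ends3)
  ultimately show ?thesis
    by (simp add: rotate3 [of "(r2, _)"] rotate3 [of "(r3, _)"])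
qed

text \<open>The left-hand side is the sum of the three nonnegative moments \<open>\<tau>(u\<^sub>2\<^sub>2 u\<^sub>0\<^sub>0 u\<^sub>2\<^sub>2 u\<^sub>1\<^sub>1)\<close>,
  \<open>\<tau>(u\<^sub>2\<^sub>3 u\<^sub>0\<^sub>1 u\<^sub>2\<^sub>3 u\<^sub>1\<^sub>2)\<close> and \<open>\<tau>(u\<^sub>2\<^sub>3 u\<^sub>1\<^sub>1 u\<^sub>2\<^sub>3 u\<^sub>0\<^sub>1)\<close>.\<close>

lemma four_cycle_nonneg:
  assumes r: "distinct [r0, r1, r2, r3]" "V = {r0, r1, r2, r3}"
    and c: "distinct [c0, c1, c2, c3]" "V = {c0, c1, c2, c3}"
  shows "0 \<le> t [(r0, c0), (r1, c1), (r2, c2)] + t [(r0, c1), (r1, c2), (r2, c3)]"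
proof -
  have ne: "r0 \<noteq> r1" "r0 \<noteq> r2" "r0 \<noteq> r3" "r1 \<noteq> r2" "r1 \<noteq> r3" "r2 \<noteq> r3"
    "c0 \<noteq> c1" "c0 \<noteq> c2" "c0 \<noteq> c3" "c1 \<noteq> c2" "c1 \<noteq> c3" "c2 \<noteq> c3"
    using r(1) c(1) by auto
  note [simp] = ne ne [symmetric]
  have V: "r0 \<in> V" "r1 \<in> V" "r2 \<in> V" "r3 \<in> V" "c3 \<in> V" using r(2) c(2) by auto
  have "t [(r2,c2), (r0,c0), (r2,c2), (r1,c1)] + t [(r2,c3), (r0,c0), (r2,c2), (r1,c1)]
      = t [(r0,c0), (r2,c2), (r1,c1)]"
    using row_sum4 [OF c V(3), of "[(r0,c0), (r2,c2), (r1,c1)]"] by (simp add: col_orth ends4)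
  moreover have "t [(r2,c0), (r0,c1), (r2,c3), (r1,c2)] + t [(r2,c3), (r0,c1), (r2,c3), (r1,c2)]
      = t [(r0,c1), (r2,c3), (r1,c2)]"
    using row_sum4 [OF c V(3), of "[(r0,c1), (r2,c3), (r1,c2)]"] by (simp add: col_orth ends4)
  \<comment> \<open>The two identities above leave the cross terms
    \<open>t [(r2,c3), (r0,c0), (r2,c2), (r1,c1)]\<close> and
    \<open>t [(r2,c0), (r0,c1), (r2,c3), (r1,c2)]\<close>. The three relations from here on show
    that they add up to the third sandwich; their right-hand sides are 0 because the remaining word
    has orthogonal ends.\<close>
  moreover have "t [(r0,c0), (r2,c2), (r1,c1), (r2,c3)] + t [(r0,c1), (r2,c2), (r1,c1), (r2,c3)] = 0"
    using row_sum4 [OF c V(1), of "[(r2,c2), (r1,c1), (r2,c3)]"] 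
    by (simp add: col_orth ends4 ends3)
  moreover have "t [(r2,c0), (r1,c1), (r2,c3), (r0,c1)] + t [(r2,c2), (r1,c1), (r2,c3), (r0,c1)]
      + t [(r2,c3), (r1,c1), (r2,c3), (r0,c1)] = 0"
    using row_sum4 [OF c V(3), of "[(r1,c1), (r2,c3), (r0,c1)]"] 
    by (simp add: col_orth ends4 ends3)
  moreover have "t [(r1,c1), (r2,c3), (r0,c1), (r2,c0)] + t [(r1,c2), (r2,c3), (r0,c1), (r2,c0)] = 0"
    using row_sum4 [OF c V(2), of "[(r2,c3), (r0,c1), (r2,c0)]"] 
    by (simp add: col_orth ends4 ends3)
  moreover have "t [(r2,c3), (r0,c0), (r2,c2), (r1,c1)] = t [(r0,c0), (r2,c2), (r1,c1), (r2,c3)]"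
    by (rule rotate4)
  moreover have "t [(r2,c0), (r0,c1), (r2,c3), (r1,c2)] = t [(r1,c2), (r2,c3), (r0,c1), (r2,c0)]"
    using rev [of "[(r1,c2), (r2,c3), (r0,c1), (r2,c0)]"] by simp
  moreover have "t [(r0,c1), (r2,c2), (r1,c1), (r2,c3)] = t [(r2,c2), (r1,c1), (r2,c3), (r0,c1)]"
    by (rule rotate4)
  moreover have "t [(r2,c0), (r1,c1), (r2,c3), (r0,c1)] = t [(r1,c1), (r2,c3), (r0,c1), (r2,c0)]"
    by (rule rotate4)
  moreover have "t [(r0,c0), (r2,c2), (r1,c1)] = t [(r0,c0), (r1,c1), (r2,c2)]"
    "t [(r0,c1), (r2,c3), (r1,c2)] = t [(r0,c1), (r1,c2), (r2,c3)]"
    by (rule swap3')+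
  ultimately show ?thesis
    using sandwich_nonneg [of "(r2,c2)" "(r0,c0)" "(r1,c1)"]
      sandwich_nonneg [of "(r2,c3)" "(r0,c1)" "(r1,c2)"]
      sandwich_nonneg [of "(r2,c3)" "(r1,c1)" "(r0,c1)"] by linarith
qed

definition triple :: "('v \<Rightarrow> 'v) \<Rightarrow> 'v \<Rightarrow> 'v \<Rightarrow> 'v \<Rightarrow> real" where
  "triple \<pi> i j k = t [(i, \<pi> i), (j, \<pi> j), (k, \<pi> k)]"

lemma triple_perm:
  "triple \<pi> j i k = triple \<pi> i j k" "triple \<pi> i k j = triple \<pi> i j k"
  "triple \<pi> j k i = triple \<pi> i j k" "triple \<pi> k i j = triple \<pi> i j k"
  "triple \<pi> k j i = triple \<pi> i j k"
proof -
  show s1: "triple \<pi> j i k = triple \<pi> i j k" for i j k unfolding triple_def by (rule swap3)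
  show s2: "triple \<pi> i k j = triple \<pi> i j k" for i j k unfolding triple_def by (rule swap3')
  show "triple \<pi> j k i = triple \<pi> i j k" by (rule trans [OF s2 s1])
  show "triple \<pi> k i j = triple \<pi> i j k" by (rule trans [OF s1 s2])
  show "triple \<pi> k j i = triple \<pi> i j k" by (rule trans [OF s1 trans [OF s2 s1]])
qed

lemma triple_third:
  assumes \<pi>: "\<pi> permutes V" and V: "distinct [i, j, k, m]" "V = {i, j, k, m}"
  shows "triple \<pi> i j m = triple \<pi> i j k"
proof -
  have "distinct [\<pi> i, \<pi> j, \<pi> k, \<pi> m]"
    using V permutes_inj [OF \<pi>] by (auto dest: injD)
  moreover have "V = {\<pi> i, \<pi> j, \<pi> k, \<pi> m}"
    using permutes_image [OF \<pi>] unfolding V(2) by simp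
  ultimately show ?thesis
    unfolding triple_def by (intro third_index [symmetric] V)
qed

text \<open>On four points the moment depends on \<open>\<pi>\<close> alone: the order of the rows
  does not matter by \<open>triple_perm\<close>, and any two three-element sets of rows share two
  rows, so \<open>triple_third\<close> compares them.\<close>

lemma triple_eq:
  assumes \<pi>: "\<pi> permutes V" and V: "distinct [a, b, c, d]" "V = {a, b, c, d}"
    and ijk: "i \<in> V" "j \<in> V" "k \<in> V" "distinct [i, j, k]"
  shows "triple \<pi> i j k = triple \<pi> a b c"
proof -
  have abd: "triple \<pi> a b d = triple \<pi> a b c"
    using V by (intro triple_third \<pi>)
  have "triple \<pi> a c d = triple \<pi> a c b"
  proof (rule triple_third [OF \<pi>])
    show "distinct [a, c, b, d]" using V(1) by auto
    show "V = {a, c, b, d}" unfolding V(2) by (simp add: insert_commute)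
  qed
  also have "\<dots> = triple \<pi> a b c" by (rule triple_perm)
  finally have acd: "triple \<pi> a c d = triple \<pi> a b c" .
  have "triple \<pi> b c d = triple \<pi> b c a"
  proof (rule triple_third [OF \<pi>])
    show "distinct [b, c, a, d]" using V(1) by auto
    show "V = {b, c, a, d}" unfolding V(2) by (simp add: insert_commute)
  qed
  also have "\<dots> = triple \<pi> a b c" by (rule triple_perm)
  finally have bcd: "triple \<pi> b c d = triple \<pi> a b c" .
  let ?T = "triple \<pi> a b c"
  have perms: "triple \<pi> x y z = ?T" "triple \<pi> x z y = ?T" "triple \<pi> y x z = ?T"
    "triple \<pi> y z x = ?T" "triple \<pi> z x y = ?T" "triple \<pi> z y x = ?T"
    if "triple \<pi> x y z = ?T" for x y z
    by (simp_all add: triple_perm [where i = x and j = y and k = z] that)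
  have "i = a \<or> i = b \<or> i = c \<or> i = d" "j = a \<or> j = b \<or> j = c \<or> j = d"
    "k = a \<or> k = b \<or> k = c \<or> k = d"
    using ijk(1-3) unfolding V(2) by auto
  then show ?thesis
    using ijk(4)
    by (elim disjE) (simp_all add: perms [OF abd] perms [OF acd] perms [OF bcd] perms(2-) [OF refl])
qed

lemma decomposable_four:
  assumes card: "card V = 4"
  shows decomposable
proof -
  obtain a b c d where V: "distinct [a, b, c, d]" "V = {a, b, c, d}"
    using card by (rule card_eq_fourE)
  define T where "T \<pi> = triple \<pi> a b c" for \<pi>
  have T: "triple \<pi> i j k = T \<pi>"
    if "\<pi> permutes V" "i \<in> V" "j \<in> V" "k \<in> V" "distinct [i, j, k]" for \<pi> i j k
    unfolding T_def using that(1) V that(2-) by (rule triple_eq)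
  \<comment> \<open>Sum over the columns of row \<open>m\<close>: the columns taken by
    \<open>i\<close> and \<open>j\<close> contribute nothing, and the other two give
    \<open>\<pi>\<close> and its modification.\<close>
  have swap_sum: "T \<pi> + T (\<pi> \<circ> Transposition.transpose m n) = t [(i, \<pi> i), (j, \<pi> j)]"
    if \<pi>: "\<pi> permutes V" and ij: "distinct [i, j, m, n]" "V = {i, j, m, n}" for \<pi> i j m n
  proof -
    let ?\<pi>' = "\<pi> \<circ> Transposition.transpose m n"
    have \<pi>': "?\<pi>' permutes V"
      using ij(2) by (intro permutes_compose permutes_swap_id \<pi>) auto
    have "distinct [\<pi> i, \<pi> j, \<pi> m, \<pi> n]"
      using ij permutes_inj [OF \<pi>] by (auto dest: injD)
    moreover have "V = {\<pi> i, \<pi> j, \<pi> m, \<pi> n}"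
      using permutes_image [OF \<pi>] unfolding ij(2) by simp
    moreover have "m \<in> V" using ij(2) by simp
    ultimately have "t [(m, \<pi> i), (i, \<pi> i), (j, \<pi> j)] + t [(m, \<pi> j), (i, \<pi> i), (j, \<pi> j)]
      + t [(m, \<pi> m), (i, \<pi> i), (j, \<pi> j)] + t [(m, \<pi> n), (i, \<pi> i), (j, \<pi> j)]
      = t [(i, \<pi> i), (j, \<pi> j)]"
      by (rule row_sum4)
    moreover have "T \<pi> = t [(m, \<pi> m), (i, \<pi> i), (j, \<pi> j)]"
      using T [OF \<pi>, of m i j] ij by (auto simp: triple_def)
    moreover have "T ?\<pi>' = t [(m, \<pi> n), (i, \<pi> i), (j, \<pi> j)]"
      using T [OF \<pi>', of m i j] ij by (auto simp: triple_def)
    ultimately show ?thesis using ij(1) by (auto simp: col_orth ends3)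
  qed
  \<comment> \<open>If \<open>inv \<pi> \<circ> \<sigma>\<close> is a transposition, the sum is a
    two-letter moment by \<open>swap_sum\<close>; if it is a 4-cycle,
    \<open>four_cycle_nonneg\<close> applies.\<close>
  have opposite: "0 \<le> T \<pi> + T \<sigma>"
    if \<pi>: "\<pi> permutes V" "evenperm \<pi>" and \<sigma>: "\<sigma> permutes V" "\<not> evenperm \<sigma>" for \<pi> \<sigma>
  proof -
    define \<rho> where "\<rho> = inv \<pi> \<circ> \<sigma>"
    have eq: "\<sigma> = \<pi> \<circ> \<rho>"
      using permutes_inverses [OF \<pi>(1)] by (auto simp: \<rho>_def)
    have perms: "permutation \<pi>" "permutation \<sigma>"
      using \<pi> \<sigma> finite_V by (auto simp: permutation_permutes)
    have "\<rho> permutes V" unfolding \<rho>_def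
      by (intro permutes_compose permutes_inv \<pi> \<sigma>)
    moreover have "\<not> evenperm \<rho>"
      using \<pi>(2) \<sigma>(2) perms by (simp add: \<rho>_def evenperm_comp evenperm_inv permutation_inverse)
    ultimately show ?thesis
    proof (rule odd_permutation_of_four [OF _ card])
      fix m n assume mn: "m \<in> V" "n \<in> V" "m \<noteq> n" "\<rho> = Transposition.transpose m n"
      have "card (V - {m, n}) = 2" using mn card finite_V by simp
      then obtain i j where ij: "V - {m, n} = {i, j}" "i \<noteq> j" by (auto simp: card_2_iff)
      with mn have "distinct [i, j, m, n]" "V = {i, j, m, n}" by auto
      then have "T \<pi> + T \<sigma> = t [(i, \<pi> i), (j, \<pi> j)]"
        unfolding eq mn(4) by (rule swap_sum [OF \<pi>(1)])
      then show ?thesis by (simp add: pair_nonneg)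
    next
      fix r0 r1 r2 r3
      assume r: "distinct [r0, r1, r2, r3]" "V = {r0, r1, r2, r3}" "\<rho> r0 = r1" "\<rho> r1 = r2" "\<rho> r2 = r3"
      have "distinct [\<pi> r0, \<pi> r1, \<pi> r2, \<pi> r3]"
        using r(1) permutes_inj [OF \<pi>(1)] by (auto dest: injD)
      moreover have "V = {\<pi> r0, \<pi> r1, \<pi> r2, \<pi> r3}"
        using permutes_image [OF \<pi>(1)] unfolding r(2) by simp
      ultimately have "0 \<le> t [(r0, \<pi> r0), (r1, \<pi> r1), (r2, \<pi> r2)]
          + t [(r0, \<pi> r1), (r1, \<pi> r2), (r2, \<pi> r3)]"
        by (rule four_cycle_nonneg [OF r(1,2)])
      also have "\<dots> = triple \<pi> r0 r1 r2 + triple \<sigma> r0 r1 r2"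
        by (simp add: triple_def eq r(3-5))
      also have "\<dots> = T \<pi> + T \<sigma>"
        using r(1,2) by (simp add: T [OF \<pi>(1)] T [OF \<sigma>(1)])
      finally show ?thesis .
    qed
  qed
  define E where "E = {\<pi>. \<pi> permutes V \<and> evenperm \<pi>}"
  have E: "finite (T ` E)" "T ` E \<noteq> {}"
    using finite_permutations [OF finite_V] permutes_id [of V]
    by (auto simp: E_def intro: finite_subset intro!: exI [of _ id])
  \<comment> \<open>The largest shift that keeps the even weights nonnegative. The odd weights are
    then nonnegative by \<open>opposite\<close> at the even permutation attaining the
    minimum.\<close>
  define C where "C = Min (T ` E)"
  define w where "w \<pi> = (if \<pi> permutes V then if evenperm \<pi> then T \<pi> - C else T \<pi> + C else 0)" for \<pi>
  have C_le: "C \<le> T \<pi>" if "\<pi> permutes V" "evenperm \<pi>" for \<pi>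
    unfolding C_def using that by (intro Min_le E) (auto simp: E_def)
  obtain \<pi>0 where \<pi>0: "\<pi>0 permutes V" "evenperm \<pi>0" "C = T \<pi>0"
    using Min_in [OF E] by (auto simp: C_def E_def)
  show ?thesis
  proof (rule decomposableI [of w])
    show "2 \<le> card V" using card by simp
    show "0 \<le> w \<pi>" for \<pi>
      using C_le [of \<pi>] opposite [OF \<pi>0(1,2), of \<pi>] \<pi>0(3) by (simp add: w_def add.commute)
    fix i j l k assume il: "i \<in> V" "j \<in> V" "l \<in> V" "k \<in> V" "i \<noteq> j" "l \<noteq> k"
    then obtain \<pi> where \<pi>: "\<pi> permutes V" "\<pi> i = l" "\<pi> j = k" by (rule exists_permutes_two)
    have "card (V - {i, j}) = 2" using il card finite_V by simp
    then obtain m n where mn: "V - {i, j} = {m, n}" "m \<noteq> n" by (auto simp: card_2_iff)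
    then have ijmn: "distinct [i, j, m, n]" "V = {i, j, m, n}" using il by auto
    let ?\<pi>' = "\<pi> \<circ> Transposition.transpose m n"
    have \<pi>': "?\<pi>' permutes V"
      using ijmn(2) by (intro permutes_compose permutes_swap_id \<pi>) auto
    have "V - {m, n} = {i, j}" using ijmn by auto
    then have agree: "(\<rho> i = l \<and> \<rho> j = k) \<longleftrightarrow> (\<forall>x\<in>V - {m, n}. \<rho> x = \<pi> x)" for \<rho>
      using \<pi>(2,3) by simp
    have "m \<in> V" "n \<in> V" using ijmn(2) by auto
    note two = permutes_eqI_two [OF \<pi>(1) this mn(2), of "\<lambda>\<rho>. \<rho> i = l \<and> \<rho> j = k", OF agree]
    have set_eq: "{\<rho>. \<rho> permutes V \<and> \<rho> i = l \<and> \<rho> j = k} = {\<pi>, ?\<pi>'}" and ne: "\<pi> \<noteq> ?\<pi>'"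
      by (rule two)+
    have "permutation \<pi>" using \<pi>(1) finite_V by (auto simp: permutation_permutes)
    \<comment> \<open>The two permutations in the marginal have opposite parity, so the shifts by
      \<open>C\<close> cancel.\<close>
    then have "evenperm ?\<pi>' \<longleftrightarrow> \<not> evenperm \<pi>"
      using mn(2) by (simp add: evenperm_comp permutation_swap_id evenperm_swap)
    then have "w \<pi> + w ?\<pi>' = T \<pi> + T ?\<pi>'" using \<pi>(1) \<pi>' by (simp add: w_def)
    then show "t [(i, l), (j, k)] = (\<Sum>\<rho> | \<rho> permutes V \<and> \<rho> i = l \<and> \<rho> j = k. w \<rho>)"
      using swap_sum [OF \<pi>(1) ijmn] \<pi>(2,3) ne unfolding set_eq by simp
  qed
qed

section \<open>Blocks of sizes two and three\<close>

text \<open>A block-preserving permutation is determined by its values at one point of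
  \<open>A\<close> and two points of \<open>B\<close>, so the moment of three such entries serves as
  its weight. No parity correction is required, as these moments are already nonnegative.\<close>

lemma decomposable_two_blocks:
  assumes V: "V = A \<union> B" "A \<inter> B = {}" and card: "card A = 2" "card B = 3"
    and block: "\<And>i l ws. \<lbrakk>i \<in> V; l \<in> V; (i \<in> A) \<noteq> (l \<in> A)\<rbrakk> \<Longrightarrow> t ((i, l) # ws) = 0"
  shows decomposable
proof -
  have sub: "A \<subseteq> V" "B \<subseteq> V" using V by auto
  have neutral: "(\<Sum>q\<in>V. g q) = (\<Sum>q\<in>S. g q)" if "S \<subseteq> V" "\<And>q. q \<in> V - S \<Longrightarrow> g q = 0"
    for S and g :: "'v \<Rightarrow> real"
    using that finite_V by (intro sum.mono_neutral_right) auto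
  have row_A: "(\<Sum>q\<in>A. t ((i, q) # ws)) = t ws" if i: "i \<in> A" for i ws
  proof -
    have "(\<Sum>q\<in>V. t ((i, q) # ws)) = (\<Sum>q\<in>A. t ((i, q) # ws))"
      using i sub V by (intro neutral block) auto
    then show ?thesis using i sub row_sum [of i ws] by auto
  qed
  have col_A: "(\<Sum>i\<in>A. t ((i, q) # ws)) = t ws" if q: "q \<in> A" for q ws
  proof -
    have "(\<Sum>i\<in>V. t ((i, q) # ws)) = (\<Sum>i\<in>A. t ((i, q) # ws))"
      using q sub V by (intro neutral block) auto
    then show ?thesis using q sub col_sum [of q ws] by auto
  qed
  have row_B: "(\<Sum>q\<in>B. t ((i, q) # ws)) = t ws" if i: "i \<in> B" for i ws
  proof -
    have "(\<Sum>q\<in>V. t ((i, q) # ws)) = (\<Sum>q\<in>B. t ((i, q) # ws))"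
      using i sub V by (intro neutral block) auto
    then show ?thesis using i sub row_sum [of i ws] by auto
  qed
  have col_B: "(\<Sum>i\<in>B. t ((i, q) # ws)) = t ws" if q: "q \<in> B" for q ws
  proof -
    have "(\<Sum>i\<in>V. t ((i, q) # ws)) = (\<Sum>i\<in>B. t ((i, q) # ws))"
      using q sub V by (intro neutral block) auto
    then show ?thesis using q sub col_sum [of q ws] by auto
  qed
  have row_A2: "t ((i, x) # ws) + t ((i, y) # ws) = t ws" if "A = {x, y}" "x \<noteq> y" "i \<in> A" for x y i ws
    using row_A [of i ws] that by simp
  have col_A2: "t ((x, q) # ws) + t ((y, q) # ws) = t ws" if "A = {x, y}" "x \<noteq> y" "q \<in> A" for x y q ws
    using col_A [of q ws] that by simp
  have row_B3: "t ((i, x) # ws) + t ((i, y) # ws) + t ((i, z) # ws) = t ws"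
    if "B = {x, y, z}" "distinct [x, y, z]" "i \<in> B" for x y z i ws
    using row_B [of i ws] that by simp
  have col_B3: "t ((x, q) # ws) + t ((y, q) # ws) + t ((z, q) # ws) = t ws"
    if "B = {x, y, z}" "distinct [x, y, z]" "q \<in> B" for x y z q ws
    using col_B [of q ws] that by simp
  define preserving where "preserving \<pi> \<longleftrightarrow> \<pi> permutes V \<and> (\<forall>x\<in>V. \<pi> x \<in> A \<longleftrightarrow> x \<in> A)" for \<pi>
  have inj: "\<pi> x = \<pi> y \<longleftrightarrow> x = y" if "preserving \<pi>" for \<pi> x y
    using that permutes_inj [of \<pi> V] by (auto simp: preserving_def dest: injD)
  have in_A: "\<pi> x \<in> A" if "preserving \<pi>" "x \<in> A" for \<pi> x
    using that sub by (auto simp: preserving_def)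
  have in_B: "\<pi> x \<in> B" if "preserving \<pi>" "x \<in> B" for \<pi> x
    using that V permutes_in_image [of \<pi> V x] by (auto simp: preserving_def)
  have finite: "finite A" "finite B" using finite_V V by auto
  have image_A: "\<pi> ` A = A" if "preserving \<pi>" for \<pi>
    using that in_A inj by (intro endo_inj_surj finite) (auto simp: inj_on_def)
  have image_B: "\<pi> ` B = B" if "preserving \<pi>" for \<pi>
    using that in_B inj by (intro endo_inj_surj finite) (auto simp: inj_on_def)
  have B_image: "B = {\<pi> x, \<pi> y, \<pi> z}" "distinct [\<pi> x, \<pi> y, \<pi> z]"
    if "preserving \<pi>" "B = {x, y, z}" "distinct [x, y, z]" for \<pi> x y z
  proof -
    show "B = {\<pi> x, \<pi> y, \<pi> z}" using image_B [OF that(1)] unfolding that(2) by simp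
    show "distinct [\<pi> x, \<pi> y, \<pi> z]" using inj [OF that(1)] that(3) by simp
  qed
  have A_image: "A = {\<pi> x, \<pi> y}" "\<pi> x \<noteq> \<pi> y"
    if "preserving \<pi>" "A = {x, y}" "x \<noteq> y" for \<pi> x y
  proof -
    show "A = {\<pi> x, \<pi> y}" using image_A [OF that(1)] unfolding that(2) by simp
    show "\<pi> x \<noteq> \<pi> y" using inj [OF that(1)] that(3) by simp
  qed
  \<comment> \<open>As in \<open>third_index\<close>: a row sum and a column sum inside
    \<open>B\<close> share the entry in row \<open>k\<close> and column
    \<open>\<pi> m\<close>.\<close>
  have third: "triple \<pi> i j k = triple \<pi> i j m"
    if \<pi>: "preserving \<pi>" and B: "B = {j, k, m}" "distinct [j, k, m]" and i: "i \<in> A" for \<pi> i j k m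
  proof -
    have "k \<in> B" "\<pi> m \<in> B" using B(1) in_B [OF \<pi>] by auto
    note r = row_B3 [OF B_image [OF \<pi> B] this(1), of "[(i, \<pi> i), (j, \<pi> j)]"]
      and c = col_B3 [OF B this(2), of "[(i, \<pi> i), (j, \<pi> j)]"]
    have "t [(k, \<pi> j), (i, \<pi> i), (j, \<pi> j)] = 0" using B(2) by (intro ends3) auto
    moreover have "t [(j, \<pi> m), (i, \<pi> i), (j, \<pi> j)] = 0"
      using B(2) inj [OF \<pi>] by (intro ends3) auto
    ultimately have "t [(k, \<pi> k), (i, \<pi> i), (j, \<pi> j)] = t [(m, \<pi> m), (i, \<pi> i), (j, \<pi> j)]"
      using r c by linarith
    then have "triple \<pi> k i j = triple \<pi> m i j" by (simp add: triple_def)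
    then show ?thesis by (simp add: triple_perm(4))
  qed
  have first: "triple \<pi> i j k = triple \<pi> i' j k"
    if \<pi>: "preserving \<pi>" and A: "A = {i, i'}" "i \<noteq> i'" for \<pi> i i' j k
  proof -
    have "i \<in> A" "\<pi> i' \<in> A" using A(1) in_A [OF \<pi>] by auto
    then show ?thesis
      using row_A2 [OF A_image [OF \<pi> A], of i "[(j, \<pi> j), (k, \<pi> k)]"]
        col_A2 [OF A, of "\<pi> i'" "[(j, \<pi> j), (k, \<pi> k)]"] by (simp add: triple_def)
  qed
  \<comment> \<open>A trace of the commutativity of a 3 x 3 magic unitary: expanding row
    \<open>j\<close> in front of \<open>[?e, ?x, ?y]\<close> leaves only the sandwich
    \<open>[?x, ?e, ?x, ?y]\<close>. The term with column \<open>\<pi> m\<close> vanishes after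
    expanding row \<open>k\<close> as well.\<close>
  have nonneg: "0 \<le> triple \<pi> i j k"
    if \<pi>: "preserving \<pi>" and B: "B = {j, k, m}" "distinct [j, k, m]" for \<pi> i j k m
  proof -
    let ?e = "(i, \<pi> i)" and ?x = "(j, \<pi> j)" and ?y = "(k, \<pi> k)"
    have mem: "j \<in> B" "k \<in> B" using B(1) by auto
    have ne: "\<pi> j \<noteq> \<pi> k" "\<pi> j \<noteq> \<pi> m" "\<pi> k \<noteq> \<pi> m" using B_image(2) [OF \<pi> B] by auto
    have "t [(k, \<pi> j), (j, \<pi> m), ?e, ?x] = 0" using B(2) by (intro ends4) auto
    moreover have "t [(k, \<pi> m), (j, \<pi> m), ?e, ?x] = 0" using B(2) by (intro col_orth) auto
    moreover have "t [(j, \<pi> m), ?e, ?x] = 0" using ne by (intro ends3) auto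
    ultimately have "t [?y, (j, \<pi> m), ?e, ?x] = 0"
      using row_B3 [OF B_image [OF \<pi> B] mem(2), of "[(j, \<pi> m), ?e, ?x]"] by simp
    then have "t [(j, \<pi> m), ?e, ?x, ?y] = 0" by (simp add: rotate4 [of ?y])
    moreover have "t [(j, \<pi> k), ?e, ?x, ?y] = 0" using B(2) by (intro ends4) auto
    ultimately have "t [?x, ?e, ?x, ?y] = t [?e, ?x, ?y]"
      using row_B3 [OF B_image [OF \<pi> B] mem(1), of "[?e, ?x, ?y]"] by simp
    then show ?thesis using sandwich_nonneg [of ?x ?e ?y] by (simp add: triple_def)
  qed
  obtain a a' where A: "A = {a, a'}" "a \<noteq> a'" using card(1) by (auto simp: card_2_iff)
  obtain b c d where B: "B = {b, c, d}" "distinct [b, c, d]" using card(2) by (auto simp: card_3_iff)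
  define w where "w \<pi> = (if preserving \<pi> then triple \<pi> a b c else 0)" for \<pi>
  \<comment> \<open>The weight may be read off from any row in \<open>A\<close> and any two rows in
    \<open>B\<close>.\<close>
  have w_eq: "w \<pi> = triple \<pi> i j k"
    if \<pi>: "preserving \<pi>" and i: "i \<in> A" and jk: "B = {j, k, m}" "distinct [j, k, m]" for \<pi> i j k m
  proof -
    have a: "a \<in> A" using A by simp
    have "triple \<pi> i j k = triple \<pi> a j k"
      using i A first [OF \<pi>, of a a' j k] by auto
    also have "\<dots> = triple \<pi> a b c"
    proof -
      have "triple \<pi> a b c = triple \<pi> a b d" by (rule third [OF \<pi> B a])
      moreover have "triple \<pi> a c b = triple \<pi> a c d"
        by (rule third [OF \<pi> _ _ a]) (use B in \<open>auto simp: insert_commute\<close>)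
      moreover have "j \<in> {b, c, d}" "k \<in> {b, c, d}" "j \<noteq> k" using jk unfolding B(1) [symmetric] by auto
      ultimately show ?thesis
        using triple_perm(2) [of \<pi> a] by (elim insertE emptyE) auto
    qed
    finally show ?thesis using \<pi> by (simp add: w_def)
  qed
  have w_zero: "w \<pi> = 0" if "\<not> preserving \<pi>" for \<pi> using that by (simp add: w_def)
  have restrict: "(\<Sum>\<pi> | \<pi> permutes V \<and> P \<pi>. w \<pi>) = (\<Sum>\<pi> | preserving \<pi> \<and> P \<pi>. w \<pi>)" for P
    using finite_permutations [OF finite_V] w_zero
    by (intro sum.mono_neutral_right) (auto simp: preserving_def)
  \<comment> \<open>Prescribing one value in each block fixes the permutation on \<open>A\<close>
    and leaves two choices on the rest of \<open>B\<close>; row \<open>m\<close> splits the moment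
    accordingly.\<close>
  have AB: "t [(i, l), (j, k)] = (\<Sum>\<pi> | preserving \<pi> \<and> \<pi> i = l \<and> \<pi> j = k. w \<pi>)"
    if ij: "i \<in> A" "j \<in> B" and lk: "l \<in> V" "k \<in> V" for i j l k
  proof (cases "l \<in> A \<and> k \<in> B")
    case False
    then have empty: "{\<pi>. preserving \<pi> \<and> \<pi> i = l \<and> \<pi> j = k} = {}"
      using ij in_A in_B by auto
    have "t [(i, l), (j, k)] = 0"
    proof (cases "l \<in> A")
      case True
      with False have "t [(j, k), (i, l)] = 0" using ij lk sub V by (intro block) auto
      then show ?thesis by (simp add: swap2)
    qed (use ij lk sub in \<open>auto intro: block\<close>)
    then show ?thesis unfolding empty by simp
  next
    case True
    \<comment> \<open>One transposition inside each block realises the prescribed values and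
      preserves both blocks.\<close>
    define \<pi> where "\<pi> = Transposition.transpose i l \<circ> Transposition.transpose j k"
    have perm: "\<pi> permutes V" unfolding \<pi>_def
      using ij True sub by (intro permutes_compose permutes_swap_id) auto
    have \<pi>ij: "\<pi> i = l" "\<pi> j = k"
      using ij True V(2) by (auto simp: \<pi>_def Transposition.transpose_def)
    have \<pi>: "preserving \<pi>"
      using perm ij True V(2) by (auto simp: preserving_def \<pi>_def Transposition.transpose_def)
    have "card (B - {j}) = 2" using ij card finite by simp
    then obtain m n where mn: "B - {j} = {m, n}" "m \<noteq> n" by (auto simp: card_2_iff)
    then have Bjmn: "B = {j, m, n}" "distinct [j, m, n]" using ij by auto
    have "card (A - {i}) = 1" using ij card finite by simp
    then obtain i' where "A - {i} = {i'}" by (auto simp: card_1_singleton_iff)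
    then have Ai: "A = {i, i'}" "i \<noteq> i'" using ij by auto
    have mn_V: "m \<in> V" "n \<in> V" using Bjmn(1) sub by auto
    have rest: "V - {m, n} = {i, i', j}" using Bjmn Ai V by auto
    have P: "(preserving \<rho> \<and> \<rho> i = l \<and> \<rho> j = k) \<longleftrightarrow> (\<forall>x\<in>V - {m, n}. \<rho> x = \<pi> x)"
      if \<rho>: "\<rho> permutes V" for \<rho>
    proof
      assume *: "preserving \<rho> \<and> \<rho> i = l \<and> \<rho> j = k"
      have "{\<rho> i, \<rho> i'} = {\<pi> i, \<pi> i'}"
        using A_image(1) [OF _ Ai, of \<rho>] A_image(1) [OF \<pi> Ai] * by simp
      then have "\<rho> i' = \<pi> i'" using * \<pi>ij by (auto simp: doubleton_eq_iff)
      then show "\<forall>x\<in>V - {m, n}. \<rho> x = \<pi> x" unfolding rest using * \<pi>ij by simp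
    next
      assume "\<forall>x\<in>V - {m, n}. \<rho> x = \<pi> x"
      then have *: "\<rho> i = \<pi> i" "\<rho> i' = \<pi> i'" "\<rho> j = \<pi> j" unfolding rest by auto
      have "\<rho> ` A = {\<rho> i, \<rho> i'}" unfolding Ai(1) by simp
      also have "\<dots> = A" unfolding * by (rule A_image(1) [OF \<pi> Ai, symmetric])
      finally have "\<rho> ` A = A" .
      then have "\<rho> x \<in> A \<longleftrightarrow> x \<in> A" for x
        using permutes_inj [OF \<rho>] by (metis image_eqI image_iff injD)
      then show "preserving \<rho> \<and> \<rho> i = l \<and> \<rho> j = k"
        using \<rho> * \<pi>ij by (simp add: preserving_def)
    qed
    let ?\<pi>' = "\<pi> \<circ> Transposition.transpose m n"
    note two = permutes_eqI_two [OF perm mn_V mn(2), of "\<lambda>\<rho>. preserving \<rho> \<and> \<rho> i = l \<and> \<rho> j = k", OF P]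
    have set_eq: "{\<rho>. preserving \<rho> \<and> \<rho> i = l \<and> \<rho> j = k} = {\<pi>, ?\<pi>'}"
      using two(1) by (auto simp: preserving_def)
    have \<pi>': "preserving ?\<pi>'" using set_eq by auto
    have "m \<in> B" "k \<in> B" using mn True by auto
    then have "t [(m, \<pi> j), (i, l), (j, k)] + t [(m, \<pi> m), (i, l), (j, k)]
        + t [(m, \<pi> n), (i, l), (j, k)] = t [(i, l), (j, k)]"
      using row_B3 [OF B_image [OF \<pi> Bjmn]] by blast
    moreover have "t [(m, \<pi> j), (i, l), (j, k)] = 0"
      using Bjmn(2) \<pi>ij by (auto intro: ends3)
    moreover have "w \<pi> = t [(m, \<pi> m), (i, l), (j, k)]"
      using w_eq [OF \<pi> ij(1) Bjmn] \<pi>ij triple_perm(4) [where i = i and j = j and k = m and \<pi> = \<pi>]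
      by (simp add: triple_def)
    moreover have "w ?\<pi>' = t [(m, \<pi> n), (i, l), (j, k)]"
    proof -
      have "i \<noteq> m" "i \<noteq> n" using ij Bjmn(1) V(2) by auto
      then show ?thesis
        using w_eq [OF \<pi>' ij(1) Bjmn] \<pi>ij triple_perm(4) [where i = i and j = j and k = m and \<pi> = ?\<pi>'] Bjmn(2)
        by (simp add: triple_def)
    qed
    ultimately show ?thesis unfolding set_eq using two(2) by simp
  qed
  \<comment> \<open>Two values in \<open>B\<close> fix the permutation on \<open>B\<close>; the two
    choices left differ by swapping \<open>a\<close> and \<open>a'\<close>, and row \<open>a\<close>
    splits the moment.\<close>
  have BB: "t [(i, l), (j, k)] = (\<Sum>\<pi> | preserving \<pi> \<and> \<pi> i = l \<and> \<pi> j = k. w \<pi>)"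
    if ij: "i \<in> B" "j \<in> B" "i \<noteq> j" and lk: "l \<in> V" "k \<in> V" "l \<noteq> k" for i j l k
  proof (cases "l \<in> B \<and> k \<in> B")
    case False
    then have empty: "{\<pi>. preserving \<pi> \<and> \<pi> i = l \<and> \<pi> j = k} = {}"
      using ij in_B by auto
    have "t [(i, l), (j, k)] = 0"
    proof (cases "l \<in> B")
      case True
      with False have "t [(j, k), (i, l)] = 0" using ij lk sub V by (intro block) auto
      then show ?thesis by (simp add: swap2)
    qed (use ij lk sub V in \<open>auto intro!: block\<close>)
    then show ?thesis unfolding empty by simp
  next
    case True
    with ij lk obtain \<pi> where \<pi>B: "\<pi> permutes B" and \<pi>ij: "\<pi> i = l" "\<pi> j = k"
      by (metis exists_permutes_two)
    have perm: "\<pi> permutes V" using \<pi>B sub(2) by (rule permutes_subset)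
    have "\<pi> x \<in> A \<longleftrightarrow> x \<in> A" if "x \<in> V" for x
    proof (cases "x \<in> B")
      case True
      then show ?thesis using permutes_in_image [OF \<pi>B, of x] V(2) by blast
    qed (simp add: permutes_not_in [OF \<pi>B])
    with perm have \<pi>: "preserving \<pi>" by (simp add: preserving_def)
    have "card (B - {i, j}) = 1" using ij card finite by simp
    then obtain z where "B - {i, j} = {z}" by (auto simp: card_1_singleton_iff)
    then have Bz: "B = {i, j, z}" "distinct [i, j, z]" using ij by auto
    have aa: "a \<in> V" "a' \<in> V" using A(1) sub by auto
    have rest: "V - {a, a'} = {i, j, z}" using A(1) Bz(1) V by auto
    have P: "(preserving \<rho> \<and> \<rho> i = l \<and> \<rho> j = k) \<longleftrightarrow> (\<forall>x\<in>V - {a, a'}. \<rho> x = \<pi> x)"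
      if \<rho>: "\<rho> permutes V" for \<rho>
    proof
      assume *: "preserving \<rho> \<and> \<rho> i = l \<and> \<rho> j = k"
      then have "\<rho> z \<in> B" "\<rho> z \<noteq> \<pi> i" "\<rho> z \<noteq> \<pi> j"
        using in_B [of \<rho> z] inj [of \<rho> z i] inj [of \<rho> z j] Bz \<pi>ij by auto
      then have "\<rho> z = \<pi> z" using B_image(1) [OF \<pi> Bz] by auto
      then show "\<forall>x\<in>V - {a, a'}. \<rho> x = \<pi> x" unfolding rest using * \<pi>ij by simp
    next
      assume "\<forall>x\<in>V - {a, a'}. \<rho> x = \<pi> x"
      then have *: "\<rho> i = \<pi> i" "\<rho> j = \<pi> j" "\<rho> z = \<pi> z" unfolding rest by auto
      have "\<rho> ` B = {\<rho> i, \<rho> j, \<rho> z}" unfolding Bz(1) by simp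
      also have "\<dots> = B" unfolding * by (rule B_image(1) [OF \<pi> Bz, symmetric])
      finally have "\<rho> ` B = B" .
      then have "\<rho> x \<in> B \<longleftrightarrow> x \<in> B" for x
        using permutes_inj [OF \<rho>] by (metis image_eqI image_iff injD)
      then show "preserving \<rho> \<and> \<rho> i = l \<and> \<rho> j = k"
        using \<rho> * \<pi>ij V permutes_in_image [OF \<rho>] by (auto simp: preserving_def)
    qed
    let ?\<pi>' = "\<pi> \<circ> Transposition.transpose a a'"
    note two = permutes_eqI_two [OF perm aa A(2), of "\<lambda>\<rho>. preserving \<rho> \<and> \<rho> i = l \<and> \<rho> j = k", OF P]
    have set_eq: "{\<rho>. preserving \<rho> \<and> \<rho> i = l \<and> \<rho> j = k} = {\<pi>, ?\<pi>'}"
      using two(1) by (auto simp: preserving_def)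
    have \<pi>': "preserving ?\<pi>'" using set_eq by auto
    have a: "a \<in> A" using A by simp
    have ne: "i \<noteq> a" "i \<noteq> a'" "j \<noteq> a" "j \<noteq> a'" using ij A(1) V(2) by auto
    have "t [(a, \<pi> a), (i, l), (j, k)] + t [(a, \<pi> a'), (i, l), (j, k)] = t [(i, l), (j, k)]"
      by (rule row_A2 [OF A_image [OF \<pi> A] a])
    moreover have "w \<pi> = t [(a, \<pi> a), (i, l), (j, k)]"
      using w_eq [OF \<pi> a Bz] \<pi>ij by (simp add: triple_def)
    moreover have "w ?\<pi>' = t [(a, \<pi> a'), (i, l), (j, k)]"
      using w_eq [OF \<pi>' a Bz] \<pi>ij ne by (simp add: triple_def)
    ultimately show ?thesis unfolding set_eq using two(2) by simp
  qed
  \<comment> \<open>In the 2 x 2 block the second letter is implied by the first. The resulting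
    one-letter moment is split over the image of a vertex of \<open>B\<close>, which reduces to
    \<open>AB\<close>.\<close>
  have AA: "t [(i, l), (j, k)] = (\<Sum>\<pi> | preserving \<pi> \<and> \<pi> i = l \<and> \<pi> j = k. w \<pi>)"
    if ij: "i \<in> A" "j \<in> A" "i \<noteq> j" and lk: "l \<in> V" "k \<in> V" "l \<noteq> k" for i j l k
  proof (cases "l \<in> A \<and> k \<in> A")
    case False
    then have empty: "{\<pi>. preserving \<pi> \<and> \<pi> i = l \<and> \<pi> j = k} = {}"
      using ij in_A by auto
    have "t [(i, l), (j, k)] = 0"
    proof (cases "l \<in> A")
      case True
      with False have "t [(j, k), (i, l)] = 0" using ij lk sub V by (intro block) auto
      then show ?thesis by (simp add: swap2)
    qed (use ij lk sub V in \<open>auto intro!: block\<close>)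
    then show ?thesis unfolding empty by simp
  next
    case True
    have Alk: "A = {l, k}"
      using True lk card finite by (intro card_seteq [symmetric]) auto
    have fin: "finite {\<pi>. preserving \<pi> \<and> \<pi> i = l}"
      using finite_permutations [OF finite_V]
      by (rule rev_finite_subset) (auto simp: preserving_def)
    have b: "b \<in> B" using B by simp
    have "t [(i, l), (j, k)] = t [(j, k), (i, l)]" by (rule swap2)
    also have "\<dots> = t [(i, l)]"
      using row_A2 [OF Alk lk(3) ij(2), of "[(i, l)]"] ij(3) by (simp add: col_orth)
    also have "\<dots> = (\<Sum>q\<in>B. t [(b, q), (i, l)])" by (simp add: row_B [OF b])
    also have "\<dots> = (\<Sum>q\<in>B. \<Sum>\<pi> | preserving \<pi> \<and> \<pi> i = l \<and> \<pi> b = q. w \<pi>)"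
      using ij b lk sub by (intro sum.cong refl) (auto simp: swap2 [of "(b, _)"] AB)
    also have "\<dots> = (\<Sum>q\<in>B. \<Sum>\<pi>\<in>{\<pi> \<in> {\<pi>. preserving \<pi> \<and> \<pi> i = l}. \<pi> b = q}. w \<pi>)"
      by (intro sum.cong) auto
    also have "\<dots> = (\<Sum>\<pi> | preserving \<pi> \<and> \<pi> i = l. w \<pi>)"
      using b in_B by (intro sum.group fin finite) auto
    also have "{\<pi>. preserving \<pi> \<and> \<pi> i = l} = {\<pi>. preserving \<pi> \<and> \<pi> i = l \<and> \<pi> j = k}"
    proof -
      have "\<pi> j = k" if "preserving \<pi>" "\<pi> i = l" for \<pi>
        using in_A [OF that(1) ij(2)] inj [OF that(1), of j i] that(2) ij(3) Alk by auto
      then show ?thesis by auto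
    qed
    finally show ?thesis .
  qed
  show ?thesis
  proof (rule decomposableI [of w])
    have "card A \<le> card V" using sub finite_V by (intro card_mono)
    then show "2 \<le> card V" using card by simp
    show "0 \<le> w \<pi>" for \<pi> using nonneg [OF _ B] by (simp add: w_def)
    fix i j l k assume il: "i \<in> V" "j \<in> V" "l \<in> V" "k \<in> V" "i \<noteq> j" "l \<noteq> k"
    show "t [(i, l), (j, k)] = (\<Sum>\<pi> | \<pi> permutes V \<and> \<pi> i = l \<and> \<pi> j = k. w \<pi>)"
      unfolding restrict
    proof (cases "i \<in> A"; cases "j \<in> A")
      assume "i \<notin> A" "j \<in> A"
      moreover have "{\<pi>. preserving \<pi> \<and> \<pi> i = l \<and> \<pi> j = k}
          = {\<pi>. preserving \<pi> \<and> \<pi> j = k \<and> \<pi> i = l}" by auto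
      ultimately show "t [(i, l), (j, k)] = (\<Sum>\<pi> | preserving \<pi> \<and> \<pi> i = l \<and> \<pi> j = k. w \<pi>)"
        using AB [of j i k l] il V by (simp add: swap2 [of "(i, l)"])
    qed (use il V AA AB BB in auto)
  qed
qed

section \<open>Splitting off a fixed vertex\<close>

text \<open>The off-diagonal entries in row and column \<open>v\<close> vanish, so deleting them
  leaves the other row and column sums unchanged.\<close>

lemma remove_fixed:
  assumes v: "v \<in> V"
    and block: "\<And>i l ws. \<lbrakk>i \<in> V; l \<in> V; (i = v) \<noteq> (l = v)\<rbrakk> \<Longrightarrow> t ((i, l) # ws) = 0"
  shows "magic_trace (V - {v}) t"
proof
  show "finite (V - {v})" using finite_V by simp
  show "(\<Sum>l\<in>V - {v}. t ((i, l) # ws)) = t ws" if "i \<in> V - {v}" for i ws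
    using row_sum [of i ws] that v finite_V by (simp add: sum.remove [of V v] block)
  show "(\<Sum>i\<in>V - {v}. t ((i, l) # ws)) = t ws" if "l \<in> V - {v}" for l ws
    using col_sum [of l ws] that v finite_V by (simp add: sum.remove [of V v] block)
qed (auto intro: rotate rev idem row_orth col_orth square_nonneg unit)

text \<open>A permutation of \<open>V - {v}\<close> already is one of \<open>V\<close> fixing
  \<open>v\<close>, so the weight extends by zero. Marginals involving \<open>v\<close> reduce to
  one-letter moments because the letter \<open>(v, v)\<close> can be inserted freely.\<close>

lemma decomposable_fixed:
  assumes v: "v \<in> V" and card: "card V \<ge> 2"
    and block: "\<And>i l ws. \<lbrakk>i \<in> V; l \<in> V; (i = v) \<noteq> (l = v)\<rbrakk> \<Longrightarrow> t ((i, l) # ws) = 0"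
    and dec: "magic_trace.decomposable (V - {v}) t"
  shows decomposable
proof -
  let ?W = "V - {v}"
  interpret W: magic_trace ?W t using v block by (rule remove_fixed)
  obtain w where nonneg: "\<And>\<pi>. 0 \<le> w \<pi>"
    and w: "\<And>i j l k. \<lbrakk>i \<in> ?W; j \<in> ?W; l \<in> ?W; k \<in> ?W\<rbrakk>
      \<Longrightarrow> t [(i, l), (j, k)] = (\<Sum>\<pi> | \<pi> permutes ?W \<and> \<pi> i = l \<and> \<pi> j = k. w \<pi>)"
    using dec unfolding W.decomposable_def by blast
  define w' where "w' \<pi> = (if \<pi> permutes ?W then w \<pi> else 0)" for \<pi>
  have restrict: "(\<Sum>\<pi> | \<pi> permutes V \<and> P \<pi>. w' \<pi>) = (\<Sum>\<pi> | \<pi> permutes ?W \<and> P \<pi>. w \<pi>)" for P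
  proof -
    have "(\<Sum>\<pi> | \<pi> permutes V \<and> P \<pi>. w' \<pi>) = (\<Sum>\<pi> | \<pi> permutes ?W \<and> P \<pi>. w' \<pi>)"
      using finite_permutations [OF finite_V]
      by (intro sum.mono_neutral_right) (auto simp: w'_def intro: permutes_subset)
    then show ?thesis by (simp add: w'_def)
  qed
  have fix_v: "\<pi> v = v" if "\<pi> permutes ?W" for \<pi> using that by (simp add: permutes_not_in)
  have moves: "\<pi> x \<noteq> v" if "\<pi> permutes ?W" "x \<in> ?W" for \<pi> x
    using permutes_in_image [OF that(1), of x] that(2) by auto
  have at_v: "t [(v, l), (j, k)] = (\<Sum>\<pi> | \<pi> permutes ?W \<and> \<pi> v = l \<and> \<pi> j = k. w \<pi>)"
    if "j \<in> ?W" "l \<in> V" "k \<in> V" "l \<noteq> k" for j l k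
  proof (cases "l = v")
    case True
    have "t [(v, v), (j, k)] = t [(j, k)]"
      using row_sum [OF v, of "[(j, k)]"] v finite_V by (simp add: sum.remove [of V v] block)
    also have "\<dots> = t [(j, k), (j, k)]" by (simp add: idem)
    also have "\<dots> = (\<Sum>\<pi> | \<pi> permutes ?W \<and> \<pi> j = k \<and> \<pi> j = k. w \<pi>)"
      using that True by (intro w) auto
    also have "{\<pi>. \<pi> permutes ?W \<and> \<pi> j = k \<and> \<pi> j = k}
        = {\<pi>. \<pi> permutes ?W \<and> \<pi> v = l \<and> \<pi> j = k}"
      using fix_v True by auto
    finally show ?thesis using True by simp
  next
    case False
    then have empty: "{\<pi>. \<pi> permutes ?W \<and> \<pi> v = l \<and> \<pi> j = k} = {}" using fix_v by auto
    show ?thesis unfolding empty using False that v by (simp add: block)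
  qed
  show ?thesis
  proof (rule decomposableI [OF card, of w'])
    show "0 \<le> w' \<pi>" for \<pi> using nonneg by (simp add: w'_def)
    fix i j l k assume il: "i \<in> V" "j \<in> V" "l \<in> V" "k \<in> V" "i \<noteq> j" "l \<noteq> k"
    show "t [(i, l), (j, k)] = (\<Sum>\<pi> | \<pi> permutes V \<and> \<pi> i = l \<and> \<pi> j = k. w' \<pi>)"
      unfolding restrict
    proof -
      consider "i = v" | "j = v" | "i \<noteq> v" "j \<noteq> v" "l = v \<or> k = v" | "i \<noteq> v" "j \<noteq> v" "l \<noteq> v" "k \<noteq> v"
        by blast
      then show "t [(i, l), (j, k)] = (\<Sum>\<pi> | \<pi> permutes ?W \<and> \<pi> i = l \<and> \<pi> j = k. w \<pi>)"
      proof cases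
        case 1
        then show ?thesis using at_v [of j l k] il by auto
      next
        case 2
        have "{\<pi>. \<pi> permutes ?W \<and> \<pi> i = l \<and> \<pi> j = k} = {\<pi>. \<pi> permutes ?W \<and> \<pi> j = k \<and> \<pi> i = l}"
          by auto
        then show ?thesis using 2 at_v [of i k l] il by (simp add: swap2 [of "(i, l)"])
      next
        case 3
        then have empty: "{\<pi>. \<pi> permutes ?W \<and> \<pi> i = l \<and> \<pi> j = k} = {}"
          using moves [of _ i] moves [of _ j] il by auto
        have "t [(i, l), (j, k)] = 0"
        proof (cases "l = v")
          case True
          then show ?thesis using 3 il by (intro block) auto
        next
          case False
          then have "t [(j, k), (i, l)] = 0" using 3 il by (intro block) auto
          then show ?thesis by (simp add: swap2)
        qed
        then show ?thesis unfolding empty by simp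
      next
        case 4
        then show ?thesis using il by (intro w) auto
      qed
    qed
  qed
qed

end


section \<open>Graphs on five vertices\<close>

text \<open>The handshake argument: pairs and their reverses are matched up.\<close>

lemma even_card_symmetric_irrefl:
  fixes E :: "('a \<times> 'a) set"
  assumes "finite E" and sym: "\<And>x y. (x, y) \<in> E \<Longrightarrow> (y, x) \<in> E"
    and irrefl: "\<And>x. (x, x) \<notin> E"
  shows "even (card E)"
proof -
  have "finite (fst ` E)" using assms(1) by simp
  \<comment> \<open>An arbitrary injection into the naturals selects one pair out of each two
    opposite ones.\<close>
  then obtain f :: "'a \<Rightarrow> nat" where f: "inj_on f (fst ` E)"
    using finite_imp_inj_to_nat_seg by metis
  define L where "L = {(x, y). (x, y) \<in> E \<and> f x < f y}"
  have "x \<in> fst ` E" "y \<in> fst ` E" if "(x, y) \<in> E" for x y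
    using that sym [OF that] by force+
  then have ne: "f x \<noteq> f y" if "(x, y) \<in> E" for x y
    using that irrefl f by (metis inj_on_eq_iff)
  have E: "E = L \<union> prod.swap ` L"
    using sym ne by (force simp: L_def image_iff neq_iff)
  have "finite L" using assms(1) by (rule rev_finite_subset) (auto simp: L_def)
  moreover have "L \<inter> prod.swap ` L = {}" by (auto simp: L_def)
  ultimately have "card E = card L + card (prod.swap ` L)"
    unfolding E by (intro card_Un_disjoint) auto
  also have "card (prod.swap ` L) = card L" by (intro card_image) (auto simp: inj_on_def)
  finally show ?thesis by simp
qed

locale pair_graph_trace = graph_trace G t + pair_graph G for G :: "'v pair_pre_digraph" and t
begin

section \<open>Neighbourhoods and degrees\<close>

abbreviation V :: "'v set" where "V \<equiv> pverts G"

definition nbrs :: "'v \<Rightarrow> 'v set" where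
  "nbrs i = {j. (i, j) \<in> parcs G}"

definition degree :: "'v \<Rightarrow> nat" where
  "degree i = card (nbrs i)"

lemma nbrs_subset: "nbrs i \<subseteq> V"
  using wellformed' by (auto simp: nbrs_def)

lemma finite_nbrs: "finite (nbrs i)"
  using nbrs_subset finite_V by (rule finite_subset)

lemma nbrs_sym: "j \<in> nbrs i \<longleftrightarrow> i \<in> nbrs j"
  using pair_sym_arcs by (auto simp: nbrs_def symmetric_def dest: symD)

lemma nbrs_irrefl: "i \<notin> nbrs i"
  using pair_no_loops [of "(i, i)"] by (auto simp: nbrs_def)

lemma rel_Adjacent: "rel G i j = Adjacent \<longleftrightarrow> j \<in> nbrs i"
  using nbrs_irrefl by (auto simp: rel_def nbrs_def)

lemma adjacent_orth:
  assumes "(j \<in> nbrs i) \<noteq> (k \<in> nbrs l)"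
  shows "t ((i, l) # (j, k) # ws) = 0"
  using assms by (intro rel_orth) (metis rel_Adjacent)

text \<open>Next to the letter \<open>(i, l)\<close>, a neighbour of \<open>i\<close> can only be
  sent to a neighbour of \<open>l\<close>, so the full row sum shrinks to
  \<open>nbrs l\<close>.\<close>

lemma nbrs_row_sum:
  assumes "j \<in> nbrs i"
  shows "(\<Sum>k\<in>nbrs l. t ((j, k) # (i, l) # ws)) = t ((i, l) # ws)"
proof -
  have "(\<Sum>k\<in>V. t ((j, k) # (i, l) # ws)) = (\<Sum>k\<in>nbrs l. t ((j, k) # (i, l) # ws))"
    using assms nbrs_subset finite_V nbrs_sym
    by (intro sum.mono_neutral_right) (auto intro!: adjacent_orth)
  then show ?thesis using assms nbrs_subset by (simp add: row_sum subset_iff)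
qed

lemma nbrs_col_sum:
  assumes "k \<in> nbrs l"
  shows "(\<Sum>j\<in>nbrs i. t ((j, k) # (i, l) # ws)) = t ((i, l) # ws)"
proof -
  have "(\<Sum>j\<in>V. t ((j, k) # (i, l) # ws)) = (\<Sum>j\<in>nbrs i. t ((j, k) # (i, l) # ws))"
    using assms nbrs_subset finite_V nbrs_sym
    by (intro sum.mono_neutral_right) (auto intro!: adjacent_orth)
  then show ?thesis using assms nbrs_subset by (simp add: col_sum subset_iff)
qed

text \<open>This is the relation \<open>U A\<^sub>G = A\<^sub>G U\<close> applied to the all-ones vector.\<close>

lemma degree_orth:
  assumes "degree i \<noteq> degree l"
  shows "t ((i, l) # ws) = 0"
proof -
  have "real (degree i) * t ((i, l) # ws)
      = (\<Sum>j\<in>nbrs i. \<Sum>k\<in>nbrs l. t ((j, k) # (i, l) # ws))"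
    by (simp add: nbrs_row_sum degree_def)
  also have "\<dots> = (\<Sum>k\<in>nbrs l. \<Sum>j\<in>nbrs i. t ((j, k) # (i, l) # ws))"
    by (rule sum.swap)
  also have "\<dots> = real (degree l) * t ((i, l) # ws)"
    by (simp add: nbrs_col_sum degree_def)
  finally show ?thesis using assms by simp
qed

lemma even_degree_sum: "even (\<Sum>i\<in>V. degree i)"
proof -
  have "parcs G = Sigma V nbrs" using wellformed' by (auto simp: nbrs_def)
  then have "card (parcs G) = (\<Sum>i\<in>V. degree i)"
    using finite_V finite_nbrs by (simp add: degree_def)
  moreover have "even (card (parcs G))"
    using pair_finite_arcs nbrs_sym nbrs_irrefl
    by (intro even_card_symmetric_irrefl) (auto simp: nbrs_def)
  ultimately show ?thesis by simp
qed

section \<open>From weights on permutations to classical correlations\<close>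

text \<open>A permutation that is not an automorphism changes the adjacency of some pair. Its weight
  is a nonnegative summand of the vanishing moment of that pair, hence zero. The total mass comes
  from summing over the image of one vertex.\<close>

lemma winning_classicalI:
  assumes dec: decomposable and nonempty: "V \<noteq> {}"
    and p: "\<And>i j l k. \<lbrakk>i \<in> V; j \<in> V; l \<in> V; k \<in> V\<rbrakk> \<Longrightarrow> p l k i j = t [(i, l), (j, k)]"
  shows "winning_classical G p"
proof -
  obtain w where nonneg: "\<And>\<pi>. 0 \<le> w \<pi>"
    and w: "\<And>i j l k. \<lbrakk>i \<in> V; j \<in> V; l \<in> V; k \<in> V\<rbrakk>
      \<Longrightarrow> t [(i, l), (j, k)] = (\<Sum>\<pi> | \<pi> permutes V \<and> \<pi> i = l \<and> \<pi> j = k. w \<pi>)"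
    using dec unfolding decomposable_def by blast
  have fin: "finite {\<pi>. \<pi> permutes V}" using finite_V by (rule finite_permutations)
  have zero: "w \<pi> = 0" if \<pi>: "\<pi> permutes V" and "\<pi> \<notin> automorphisms G" for \<pi>
  proof -
    have mem: "\<pi> x \<in> V \<longleftrightarrow> x \<in> V" for x using \<pi> by (rule permutes_in_image)
    have "\<not> (\<forall>i\<in>V. \<forall>j\<in>V. (\<pi> i, \<pi> j) \<in> parcs G \<longleftrightarrow> (i, j) \<in> parcs G)"
      using that by (simp add: automorphisms_def)
    then obtain i j where ij: "i \<in> V" "j \<in> V" "(\<pi> i, \<pi> j) \<in> parcs G \<longleftrightarrow> (i, j) \<notin> parcs G"
      by blast
    have "w \<pi> \<le> (\<Sum>\<rho> | \<rho> permutes V \<and> \<rho> i = \<pi> i \<and> \<rho> j = \<pi> j. w \<rho>)"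
      using \<pi> nonneg by (intro member_le_sum) (auto intro: finite_subset [OF _ fin])
    also have "\<dots> = t [(i, \<pi> i), (j, \<pi> j)]" using ij mem by (intro w [symmetric]) auto
    also have "\<dots> = 0" using ij(3) by (intro adjacent_orth) (auto simp: nbrs_def)
    finally show ?thesis using nonneg [of \<pi>] by linarith
  qed
  have aut: "automorphisms G \<subseteq> {\<pi>. \<pi> permutes V}" by (auto simp: automorphisms_def)
  have fin_aut: "finite (automorphisms G)" using aut fin by (rule finite_subset)
  obtain i where i: "i \<in> V" using nonempty by blast
  have "(\<Sum>\<pi>\<in>automorphisms G. w \<pi>) = (\<Sum>\<pi> | \<pi> permutes V. w \<pi>)"
    using aut fin zero by (intro sum.mono_neutral_left) auto
  also have "\<dots> = (\<Sum>l\<in>V. \<Sum>\<pi>\<in>{\<pi> \<in> {\<pi>. \<pi> permutes V}. \<pi> i = l}. w \<pi>)"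
    using i by (intro sum.group [symmetric] fin finite_V) (auto simp: permutes_in_image)
  also have "\<dots> = (\<Sum>l\<in>V. t [(i, l), (i, l)])"
    using i by (intro sum.cong refl) (simp add: w)
  also have "\<dots> = 1" using row_sum [OF i, of "[]"] by (simp add: idem unit)
  finally have total: "(\<Sum>\<pi>\<in>automorphisms G. w \<pi>) = 1" .
  have "p l k i j = (\<Sum>\<pi>\<in>automorphisms G. w \<pi> * deterministic_corr \<pi> l k i j)"
    if V: "l \<in> V" "k \<in> V" "i \<in> V" "j \<in> V" for l k i j
  proof -
    have "(\<Sum>\<pi>\<in>automorphisms G. w \<pi> * deterministic_corr \<pi> l k i j)
        = (\<Sum>\<pi>\<in>automorphisms G. if \<pi> i = l \<and> \<pi> j = k then w \<pi> else 0)"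
      by (intro sum.cong) (auto simp: deterministic_corr_def)
    also have "\<dots> = (\<Sum>\<pi>\<in>{\<pi> \<in> automorphisms G. \<pi> i = l \<and> \<pi> j = k}. w \<pi>)"
      using fin_aut by (simp add: sum.inter_filter)
    also have "\<dots> = (\<Sum>\<pi> | \<pi> permutes V \<and> \<pi> i = l \<and> \<pi> j = k. w \<pi>)"
      using aut zero by (intro sum.mono_neutral_left) (auto intro: finite_subset [OF _ fin])
    finally show ?thesis using V by (simp add: p w)
  qed
  with nonneg total show ?thesis unfolding winning_classical_def by blast
qed

section \<open>The 5-cycle\<close>

definition five_cycle :: "'v \<Rightarrow> 'v \<Rightarrow> 'v \<Rightarrow> 'v \<Rightarrow> 'v \<Rightarrow> bool" where
  "five_cycle a b c d e \<longleftrightarrow> distinct [a, b, c, d, e] \<and> V = {a, b, c, d, e} \<and>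
     nbrs a = {e, b} \<and> nbrs b = {a, c} \<and> nbrs c = {b, d} \<and> nbrs d = {c, e} \<and> nbrs e = {d, a}"

lemma five_cycleD:
  assumes "five_cycle a b c d e"
  shows "nbrs a = {e, b}" "nbrs b = {a, c}" "nbrs c = {b, d}" "nbrs d = {c, e}" "nbrs e = {d, a}"
    and "distinct [a, b, c, d, e]" "V = {a, b, c, d, e}"
  using assms unfolding five_cycle_def by simp_all

lemma five_cycle_rotate:
  assumes "five_cycle a b c d e" shows "five_cycle b c d e a"
proof -
  have "distinct [b, c, d, e, a]" using five_cycleD(6) [OF assms] by auto
  then show ?thesis
    unfolding five_cycle_def five_cycleD [OF assms] by (simp add: insert_commute)
qed

lemma five_cycle_reverse:
  assumes "five_cycle a b c d e" shows "five_cycle e d c b a"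
proof -
  have "distinct [e, d, c, b, a]" using five_cycleD(6) [OF assms] by auto
  then show ?thesis
    unfolding five_cycle_def five_cycleD [OF assms] by (simp add: insert_commute)
qed

text \<open>Follow the edge from \<open>i\<close> to \<open>j\<close> in both directions, to
  \<open>e\<close> beyond \<open>i\<close> and \<open>c\<close> beyond \<open>j\<close>. These
  differ, and the fifth vertex must be adjacent to exactly \<open>c\<close> and
  \<open>e\<close>.\<close>

lemma five_cycle_exists:
  assumes card: "card V = 5" and deg: "\<And>i. i \<in> V \<Longrightarrow> degree i = 2" and j: "j \<in> nbrs i"
  obtains c d e where "five_cycle i j c d e"
proof -
  have mem: "x \<in> V" if "x \<in> nbrs y" for x y using that nbrs_subset by blast
  have card2: "card (nbrs x) = 2" if "x \<in> V" for x using deg that by (simp add: degree_def)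
  have pair: "nbrs x = {y, z}" if "y \<in> nbrs x" "z \<in> nbrs x" "y \<noteq> z" for x y z
  proof -
    have "x \<in> V" using that(1) nbrs_sym mem by blast
    then show ?thesis
      using that card2 by (intro card_seteq [symmetric] finite_nbrs) auto
  qed
  have other: "\<exists>z. z \<in> nbrs x \<and> z \<noteq> y" if "y \<in> nbrs x" for x y
  proof (rule ccontr)
    assume "\<nexists>z. z \<in> nbrs x \<and> z \<noteq> y"
    then have "nbrs x \<subseteq> {y}" by blast
    then have "card (nbrs x) \<le> 1" using card_mono [of "{y}" "nbrs x"] by simp
    moreover have "x \<in> V" using that nbrs_sym mem by blast
    ultimately show False using card2 by fastforce
  qed
  have ij: "i \<in> nbrs j" using j nbrs_sym by blast
  obtain e where e: "e \<in> nbrs i" "e \<noteq> j" using other [OF j] by blast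
  obtain c where c: "c \<in> nbrs j" "c \<noteq> i" using other [OF ij] by blast
  have V: "i \<in> V" "j \<in> V" "c \<in> V" "e \<in> V" using ij j c e mem by blast+
  have ne: "i \<noteq> j" "i \<noteq> e" "j \<noteq> c"
    using j e c nbrs_irrefl by blast+
  have ni: "nbrs i = {e, j}" using e j by (intro pair)
  have nj: "nbrs j = {i, c}" using c ij by (intro pair) auto
  have jc: "j \<in> nbrs c" and ie: "i \<in> nbrs e" using c e nbrs_sym by blast+
  have not_nbr: "y \<notin> nbrs x" if "x \<notin> nbrs y" for x y using that nbrs_sym by blast
  \<comment> \<open>Otherwise \<open>i\<close>, \<open>j\<close>, \<open>c\<close> form a triangle,
    and each of the other two vertices has at most one neighbour.\<close>
  have "c \<noteq> e"
  proof
    assume ce: "c = e"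
    have nc: "nbrs c = {i, j}" using jc ie ce ne(1) by (intro pair) auto
    have "card (V - {i, j, c}) = 2" using V ne c(2) card finite_V by simp
    then obtain x y where xy: "V - {i, j, c} = {x, y}" "x \<noteq> y" by (auto simp: card_2_iff)
    then have "x \<in> V - {i, j, c}" by simp
    then have x: "x \<in> V" "x \<noteq> i" "x \<noteq> j" "x \<noteq> c" by simp_all
    have "x \<notin> nbrs i" "x \<notin> nbrs j" "x \<notin> nbrs c"
      using x(2-4) ce unfolding ni nj nc by auto
    then have "i \<notin> nbrs x" "j \<notin> nbrs x" "c \<notin> nbrs x" "x \<notin> nbrs x"
      by (simp_all add: not_nbr nbrs_irrefl)
    then have "nbrs x \<subseteq> (V - {i, j, c}) - {x}" using nbrs_subset [of x] by blast
    then have "nbrs x \<subseteq> {y}" unfolding xy(1) by auto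
    then have "card (nbrs x) \<le> 1" using card_mono [of "{y}" "nbrs x"] by simp
    then show False using card2 [OF x(1)] by simp
  qed
  have "card (V - {i, j, c, e}) = 1" using V ne c(2) e(2) \<open>c \<noteq> e\<close> card finite_V by simp
  then obtain d where d: "V - {i, j, c, e} = {d}" by (auto simp: card_1_singleton_iff)
  then have "d \<in> V - {i, j, c, e}" by simp
  then have dne: "d \<noteq> i" "d \<noteq> j" "d \<noteq> c" "d \<noteq> e" and dV: "d \<in> V" by simp_all
  have "V = (V - {i, j, c, e}) \<union> {i, j, c, e}" using V by blast
  then have VV: "V = {i, j, c, d, e}" unfolding d by (simp add: insert_commute)
  have "i \<notin> nbrs d" "j \<notin> nbrs d" "d \<notin> nbrs d"
    using dne not_nbr [of d i] not_nbr [of d j] nbrs_irrefl [of d] by (simp_all add: ni nj)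
  then have "nbrs d \<subseteq> V - {i, j, d}" using nbrs_subset [of d] by blast
  also have "\<dots> \<subseteq> {c, e}" unfolding VV by auto
  finally have "nbrs d \<subseteq> {c, e}" .
  then have nd: "nbrs d = {c, e}"
    using card2 [OF dV] \<open>c \<noteq> e\<close> by (intro card_seteq) auto
  have "c \<in> nbrs d" "e \<in> nbrs d" using nd by simp_all
  then have "d \<in> nbrs c" "d \<in> nbrs e" using nbrs_sym by blast+
  then have nc: "nbrs c = {j, d}" and n_e: "nbrs e = {d, i}"
    using pair [OF jc _ dne(2) [symmetric]] pair [OF _ ie dne(1)] by blast+
  have "distinct [i, j, c, d, e]"
    using ne e(2) c(2) dne \<open>c \<noteq> e\<close> by auto
  then have "five_cycle i j c d e"
    unfolding five_cycle_def ni nj nc nd n_e using VV by simp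
  then show thesis by (rule that)
qed

text \<open>The row sum of \<open>c\<close> over \<open>nbrs b'\<close> and the column sum of
  \<open>a'\<close> over \<open>nbrs b\<close> share the term
  \<open>t [(c, a'), (b, b')]\<close>.\<close>

lemma five_cycle_edge_shift:
  assumes r: "five_cycle a b c d e" and s: "five_cycle a' b' c' d' e'"
  shows "t [(a, a'), (b, b')] = t [(b, b'), (c, c')]"
proof -
  have "nbrs b = {a, c}" "a \<noteq> c" "nbrs b' = {a', c'}" "a' \<noteq> c'"
    using five_cycleD(2,6) [OF r] five_cycleD(2,6) [OF s] by auto
  then have "t [(c, a'), (b, b')] + t [(c, c'), (b, b')] = t [(b, b')]"
    "t [(a, a'), (b, b')] + t [(c, a'), (b, b')] = t [(b, b')]"
    using nbrs_row_sum [of c b b' "[]"] nbrs_col_sum [of a' b' b "[]"] by auto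
  then show ?thesis by (simp add: swap2 [of "(b, b')"])
qed

text \<open>Insert the midpoint \<open>b\<close>: its image is adjacent to both \<open>a'\<close>
  and \<open>c'\<close>, so it is \<open>b'\<close>. The letter \<open>(c, c')\<close> can then be
  dropped, since the other neighbour of \<open>b'\<close> is already taken by
  \<open>a\<close>.\<close>

lemma five_cycle_distance_two:
  assumes r: "five_cycle a b c d e" and s: "five_cycle a' b' c' d' e'"
  shows "t [(a, a'), (c, c')] = t [(a, a'), (b, b')]"
proof -
  have r': "nbrs a = {e, b}" "nbrs b = {a, c}" "a \<noteq> c"
    and s': "nbrs a' = {e', b'}" "nbrs b' = {a', c'}" "nbrs c' = {b', d'}" "e' \<noteq> b'" "e' \<noteq> d'" "a' \<noteq> c'"
    using five_cycleD(1-3,6) [OF r] five_cycleD(1-3,6) [OF s] by auto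
  have "t [(c, c'), (b, e'), (a, a')] = 0"
    using r' s' nbrs_sym [of c b] by (intro adjacent_orth) auto
  then have "t [(b, e'), (a, a'), (c, c')] = 0" by (simp add: rotate3 [of "(c, c')"])
  then have "t [(a, a'), (c, c')] = t [(b, b'), (a, a'), (c, c')]"
    using nbrs_row_sum [of b a a' "[(c, c')]"] r' s' by simp
  also have "\<dots> = t [(c, c'), (b, b'), (a, a')]" by (simp add: rotate3 [of "(c, c')"])
  also have "\<dots> = t [(b, b'), (a, a')]"
  proof -
    have "t [(c, a'), (b, b'), (a, a')] = 0" using r' by (intro ends3) auto
    then show ?thesis using nbrs_row_sum [of c b b' "[(a, a')]"] r' s' by simp
  qed
  finally show ?thesis by (simp add: swap2)
qed

lemma five_cycle_unique:
  assumes r: "five_cycle a b c d e" and s: "five_cycle a b c' d' e'"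
  shows "c' = c" "d' = d" "e' = e"
proof -
  show c: "c' = c"
    using five_cycleD(2,6) [OF r] five_cycleD(2,6) [OF s] by (auto simp: doubleton_eq_iff)
  show "e' = e"
    using five_cycleD(1,6) [OF r] five_cycleD(1,6) [OF s] by (auto simp: doubleton_eq_iff)
  show "d' = d"
    using five_cycleD(3,6) [OF r] five_cycleD(3,6) [OF s] c by (auto simp: doubleton_eq_iff)
qed

lemma five_cycle_midpoint:
  assumes "five_cycle a b c d e" "x \<in> nbrs a" "x \<in> nbrs c"
  shows "x = b"
  using five_cycleD(1,3,6) [OF assms(1)] assms(2,3) by auto

lemma automorphismsD:
  assumes "\<pi> \<in> automorphisms G"
  shows "\<pi> permutes V" and "x \<in> V \<Longrightarrow> y \<in> V \<Longrightarrow> \<pi> y \<in> nbrs (\<pi> x) \<longleftrightarrow> y \<in> nbrs x"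
  using assms by (auto simp: automorphisms_def nbrs_def)

lemma automorphism_nbrs:
  assumes \<pi>: "\<pi> \<in> automorphisms G" and x: "x \<in> V"
  shows "nbrs (\<pi> x) = \<pi> ` nbrs x"
proof
  show "\<pi> ` nbrs x \<subseteq> nbrs (\<pi> x)"
    using automorphismsD(2) [OF \<pi> x] nbrs_subset by blast
  show "nbrs (\<pi> x) \<subseteq> \<pi> ` nbrs x"
  proof
    fix y assume y: "y \<in> nbrs (\<pi> x)"
    then have "y \<in> \<pi> ` V"
      using nbrs_subset permutes_image [OF automorphismsD(1) [OF \<pi>]] by blast
    then show "y \<in> \<pi> ` nbrs x" using y automorphismsD(2) [OF \<pi> x] by blast
  qed
qed

lemma automorphism_five_cycle:
  assumes \<pi>: "\<pi> \<in> automorphisms G" and cyc: "five_cycle a b c d e"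
  shows "five_cycle (\<pi> a) (\<pi> b) (\<pi> c) (\<pi> d) (\<pi> e)"
proof -
  note perm = automorphismsD(1) [OF \<pi>]
  have mem: "a \<in> V" "b \<in> V" "c \<in> V" "d \<in> V" "e \<in> V"
    using five_cycleD(7) [OF cyc] by simp_all
  have "\<pi> x = \<pi> y \<longleftrightarrow> x = y" for x y using permutes_inj [OF perm] by (auto dest: injD)
  then have "distinct [\<pi> a, \<pi> b, \<pi> c, \<pi> d, \<pi> e]"
    using five_cycleD(6) [OF cyc] by simp
  moreover have "V = {\<pi> a, \<pi> b, \<pi> c, \<pi> d, \<pi> e}"
    using permutes_image [OF perm] unfolding five_cycleD(7) [OF cyc] by simp
  ultimately show ?thesis
    unfolding five_cycle_def automorphism_nbrs [OF \<pi> mem(1)] automorphism_nbrs [OF \<pi> mem(2)]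
      automorphism_nbrs [OF \<pi> mem(3)] automorphism_nbrs [OF \<pi> mem(4)]
      automorphism_nbrs [OF \<pi> mem(5)] five_cycleD(1-5) [OF cyc] by simp
qed

text \<open>The dihedral group acts simply transitively on directed edges. Existence is read off
  from the two lists; for uniqueness, the image of the first cycle is compared with the
  second.\<close>

lemma five_cycle_automorphism:
  assumes r: "five_cycle a b c d e" and s: "five_cycle a' b' c' d' e'"
  obtains \<pi> where "\<pi> \<in> automorphisms G" "\<pi> a = a'" "\<pi> b = b'"
    "\<And>\<rho>. \<lbrakk>\<rho> \<in> automorphisms G; \<rho> a = a'; \<rho> b = b'\<rbrakk> \<Longrightarrow> \<rho> = \<pi>"
proof -
  define \<pi> where "\<pi> = permutation_of_list [(a, a'), (b, b'), (c, c'), (d, d'), (e, e')]"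
  have "a \<noteq> b" "a \<noteq> c" "a \<noteq> d" "a \<noteq> e" "b \<noteq> c" "b \<noteq> d" "b \<noteq> e" "c \<noteq> d" "c \<noteq> e" "d \<noteq> e"
    "a' \<noteq> b'" "a' \<noteq> c'" "a' \<noteq> d'" "a' \<noteq> e'" "b' \<noteq> c'" "b' \<noteq> d'" "b' \<noteq> e'" "c' \<noteq> d'" "c' \<noteq> e'" "d' \<noteq> e'"
    using five_cycleD(6) [OF r] five_cycleD(6) [OF s] by simp_all
  note ne = this this [symmetric]
  have \<pi>: "\<pi> a = a'" "\<pi> b = b'" "\<pi> c = c'" "\<pi> d = d'" "\<pi> e = e'"
    by (simp_all add: \<pi>_def ne)
  have V: "V = {a, b, c, d, e}" "V = {a', b', c', d', e'}"
    by (rule five_cycleD(7) [OF r], rule five_cycleD(7) [OF s])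
  have perm: "\<pi> permutes V" unfolding \<pi>_def
  proof (rule permutation_of_list_permutes)
    show "list_permutes [(a, a'), (b, b'), (c, c'), (d, d'), (e, e')] V"
      by (simp add: list_permutes_def ne V [symmetric])
  qed
  have "\<pi> y \<in> nbrs (\<pi> x) \<longleftrightarrow> y \<in> nbrs x" if "x \<in> V" "y \<in> V" for x y
  proof -
    have "x = a \<or> x = b \<or> x = c \<or> x = d \<or> x = e" "y = a \<or> y = b \<or> y = c \<or> y = d \<or> y = e"
      using that unfolding V(1) by simp_all
    then show ?thesis
      by (elim disjE) (simp_all add: \<pi> five_cycleD(1-5) [OF r] five_cycleD(1-5) [OF s] ne)
  qed
  then have aut: "\<pi> \<in> automorphisms G"
    using perm by (simp add: automorphisms_def nbrs_def)
  have "\<rho> = \<pi>" if \<rho>: "\<rho> \<in> automorphisms G" "\<rho> a = a'" "\<rho> b = b'" for \<rho>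
  proof -
    have "five_cycle a' b' (\<rho> c) (\<rho> d) (\<rho> e)"
      using automorphism_five_cycle [OF \<rho>(1) r] \<rho>(2,3) by simp
    then have "\<rho> c = c'" "\<rho> d = d'" "\<rho> e = e'"
      using five_cycle_unique [OF s] by blast+
    then have eq: "\<rho> x = \<pi> x" if "x \<in> V" for x
      using that \<rho>(2,3) \<pi> unfolding V(1) by auto
    show ?thesis
    proof
      fix x show "\<rho> x = \<pi> x"
        using eq [of x] permutes_not_in [OF automorphismsD(1) [OF \<rho>(1)], of x]
          permutes_not_in [OF perm, of x] by (cases "x \<in> V") simp_all
    qed
  qed
  with aut \<pi>(1,2) show thesis by (rule that)
qed

text \<open>The weight of an automorphism is its two-letter moment on an edge, the same for every
  edge. A pair of matching edges extends to a single automorphism, so edge marginals have one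
  possible nonzero term; pairs at distance two reduce to edges through their midpoints.\<close>

lemma decomposable_five_cycle:
  assumes card: "card V = 5" and deg: "\<And>i. i \<in> V \<Longrightarrow> degree i = 2"
  shows decomposable
proof -
  note exists = five_cycle_exists [OF card deg]
  have distance_two: "\<exists>m n q. five_cycle i m j n q"
    if ij: "i \<in> V" "j \<in> V" "i \<noteq> j" "j \<notin> nbrs i" for i j
  proof -
    have "nbrs i \<noteq> {}" using deg [OF ij(1)] by (auto simp: degree_def)
    then obtain b where "b \<in> nbrs i" by blast
    then obtain c d e where cyc: "five_cycle i b c d e" using exists by blast
    then have "j = c \<or> j = d"
      using ij five_cycleD(1) [OF cyc] unfolding five_cycleD(7) [OF cyc] by auto
    moreover have "five_cycle i e d c b"
      using five_cycle_reverse [OF five_cycle_rotate [OF cyc]] .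
    ultimately show ?thesis using cyc by blast
  qed
  have "V \<noteq> {}" using card by auto
  then obtain a where a: "a \<in> V" by blast
  then have "nbrs a \<noteq> {}" using deg [OF a] by (auto simp: degree_def)
  then obtain b where "b \<in> nbrs a" by blast
  then obtain c d e where base: "five_cycle a b c d e" using exists by blast
  define w where "w \<pi> = (if \<pi> \<in> automorphisms G then t [(a, \<pi> a), (b, \<pi> b)] else 0)" for \<pi>
  \<comment> \<open>Rotating the cycle carries the moment from one edge to the next, and
    \<open>swap2\<close> covers the reversed edges.\<close>
  have w_edge: "t [(i, \<pi> i), (j, \<pi> j)] = w \<pi>"
    if \<pi>: "\<pi> \<in> automorphisms G" and j: "j \<in> nbrs i" for \<pi> i j
  proof -
    define f where "f x y = t [(x, \<pi> x), (y, \<pi> y)]" for x y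
    have sym: "f x y = f y x" for x y unfolding f_def by (rule swap2)
    have shift: "f x y = f y z" if "five_cycle x y z u v" for x y z u v
      unfolding f_def using that automorphism_five_cycle [OF \<pi> that] by (rule five_cycle_edge_shift)
    note base1 = five_cycle_rotate [OF base]
    note base2 = five_cycle_rotate [OF base1]
    note base3 = five_cycle_rotate [OF base2]
    have "f a b = f b c" "f b c = f c d" "f c d = f d e" "f d e = f e a"
      using shift [OF base] shift [OF base1] shift [OF base2] shift [OF base3] by blast+
    then have edges: "f b c = f a b" "f c d = f a b" "f d e = f a b" "f e a = f a b"
      by simp_all
    then have edges': "f b a = f a b" "f c b = f a b" "f d c = f a b" "f e d = f a b" "f a e = f a b"
      using sym [of b a] sym [of c b] sym [of d c] sym [of e d] sym [of a e] by simp_all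
    have "i \<in> V" using j nbrs_sym nbrs_subset by blast
    then have "i = a \<or> i = b \<or> i = c \<or> i = d \<or> i = e"
      unfolding five_cycleD(7) [OF base] by simp
    then have "f i j = f a b"
      using j by (elim disjE) (auto simp: five_cycleD(1-5) [OF base] edges edges')
    then show ?thesis using \<pi> by (simp add: f_def w_def)
  qed
  have fin: "finite {\<pi>. \<pi> permutes V \<and> P \<pi>}" for P
    using finite_permutations [OF finite_V] by (rule rev_finite_subset) auto
  have edge: "t [(i, l), (j, k)] = (\<Sum>\<pi> | \<pi> permutes V \<and> \<pi> i = l \<and> \<pi> j = k. w \<pi>)"
    if ij: "i \<in> V" "j \<in> V" "j \<in> nbrs i" for i j l k
  proof (cases "k \<in> nbrs l")
    case False
    then have "w \<pi> = 0" if "\<pi> i = l" "\<pi> j = k" for \<pi>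
      using that automorphismsD(2) [of \<pi> i j] ij by (auto simp: w_def)
    then have "(\<Sum>\<pi> | \<pi> permutes V \<and> \<pi> i = l \<and> \<pi> j = k. w \<pi>) = 0"
      by (intro sum.neutral) auto
    moreover have "t [(i, l), (j, k)] = 0" using False ij by (intro adjacent_orth) auto
    ultimately show ?thesis by simp
  next
    case True
    obtain c1 d1 e1 where cyc1: "five_cycle i j c1 d1 e1" using exists ij(3) by blast
    obtain c2 d2 e2 where cyc2: "five_cycle l k c2 d2 e2" using exists True by blast
    obtain \<pi> where \<pi>: "\<pi> \<in> automorphisms G" "\<pi> i = l" "\<pi> j = k"
      and unique: "\<And>\<rho>. \<lbrakk>\<rho> \<in> automorphisms G; \<rho> i = l; \<rho> j = k\<rbrakk> \<Longrightarrow> \<rho> = \<pi>"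
      using five_cycle_automorphism [OF cyc1 cyc2] by blast
    have "w \<rho> = 0" if "\<rho> \<noteq> \<pi>" "\<rho> i = l" "\<rho> j = k" for \<rho>
      using unique [of \<rho>] that by (auto simp: w_def)
    then have "(\<Sum>\<pi> | \<pi> permutes V \<and> \<pi> i = l \<and> \<pi> j = k. w \<pi>) = (\<Sum>\<pi>\<in>{\<pi>}. w \<pi>)"
      using \<pi>(2,3) automorphismsD(1) [OF \<pi>(1)]
      by (intro sum.mono_neutral_right fin) auto
    then show ?thesis using w_edge [OF \<pi>(1) ij(3)] \<pi>(2,3) by simp
  qed
  show ?thesis
  proof (rule decomposableI [of w])
    show "2 \<le> card V" using card by simp
    show "0 \<le> w \<pi>" for \<pi> by (simp add: w_def pair_nonneg)
    fix i j l k assume il: "i \<in> V" "j \<in> V" "l \<in> V" "k \<in> V" "i \<noteq> j" "l \<noteq> k"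
    show "t [(i, l), (j, k)] = (\<Sum>\<pi> | \<pi> permutes V \<and> \<pi> i = l \<and> \<pi> j = k. w \<pi>)"
    proof (cases "j \<in> nbrs i")
      case True
      then show ?thesis using il by (intro edge)
    next
      case False
      show ?thesis
      proof (cases "k \<in> nbrs l")
        case True
        then have "w \<pi> = 0" if "\<pi> i = l" "\<pi> j = k" for \<pi>
          using that automorphismsD(2) [of \<pi> i j] il False by (auto simp: w_def)
        then have "(\<Sum>\<pi> | \<pi> permutes V \<and> \<pi> i = l \<and> \<pi> j = k. w \<pi>) = 0"
          by (intro sum.neutral) auto
        moreover have "t [(i, l), (j, k)] = 0" using True False by (intro adjacent_orth) auto
        ultimately show ?thesis by simp
      next
        case not_adj: False
        obtain m n q where cyc: "five_cycle i m j n q" using distance_two il False by blast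
        obtain m' n' q' where cyc': "five_cycle l m' k n' q'" using distance_two il not_adj by blast
        have m: "m \<in> nbrs i" "m' \<in> nbrs l"
          using five_cycleD(1) [OF cyc] five_cycleD(1) [OF cyc'] by simp_all
        then have mV: "m \<in> V" "m' \<in> V" using nbrs_subset by blast+
        have image: "five_cycle (\<pi> i) (\<pi> m) (\<pi> j) (\<pi> n) (\<pi> q)"
          if "\<pi> \<in> automorphisms G" for \<pi>
          using that cyc by (rule automorphism_five_cycle)
        \<comment> \<open>Automorphisms carry midpoints to midpoints, so among those sending
          \<open>i\<close> to \<open>l\<close> the conditions on \<open>j\<close> and on
          \<open>m\<close> agree.\<close>
        have same: "\<pi> j = k \<longleftrightarrow> \<pi> m = m'" if \<pi>: "\<pi> \<in> automorphisms G" "\<pi> i = l" for \<pi>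
        proof
          assume "\<pi> j = k"
          then show "\<pi> m = m'"
            using five_cycle_midpoint [OF cyc'] five_cycleD(1,3) [OF image [OF \<pi>(1)]] \<pi>(2) by simp
        next
          assume "\<pi> m = m'"
          then show "\<pi> j = k"
            using five_cycle_unique(1) [OF cyc'] image [OF \<pi>(1)] \<pi>(2) by simp
        qed
        have "t [(i, l), (j, k)] = t [(i, l), (m, m')]"
          using cyc cyc' by (rule five_cycle_distance_two)
        also have "\<dots> = (\<Sum>\<pi> | \<pi> permutes V \<and> \<pi> i = l \<and> \<pi> m = m'. w \<pi>)"
          using il m mV by (intro edge)
        also have "\<dots> = (\<Sum>\<pi> | \<pi> permutes V \<and> \<pi> i = l \<and> \<pi> j = k. w \<pi>)"
          using same by (intro sum.mono_neutral_cong fin) (auto simp: w_def)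
        finally show ?thesis .
      qed
    qed
  qed
qed

section \<open>Case analysis by degree\<close>

text \<open>Take the degree class \<open>C\<close> of one vertex. Size 1 or 4 isolates a vertex,
  size 2 or 3 gives a pair and its complement, and size 5 means regular. \<open>degree_orth\<close>
  supplies the vanishing entries in the first two situations.\<close>

lemma decomposable_five_vertices:
  assumes card: "card V = 5" and not_empty: "\<exists>i\<in>V. degree i \<noteq> 0"
    and not_complete: "\<exists>i\<in>V. degree i \<noteq> 4"
  shows decomposable
proof -
  have unique_degree: decomposable if v: "v \<in> V" and unique: "\<And>x. x \<in> V \<Longrightarrow> degree x = degree v \<Longrightarrow> x = v" for v
  proof -
    have block: "t ((i, l) # ws) = 0" if "i \<in> V" "l \<in> V" "(i = v) \<noteq> (l = v)" for i l ws
      using that unique [of i] unique [of l] by (intro degree_orth) auto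
    interpret W: magic_trace "V - {v}" t using v block by (rule remove_fixed)
    have "W.decomposable" using v card finite_V by (intro W.decomposable_four) simp
    then show ?thesis using v card block by (intro decomposable_fixed) auto
  qed
  have two_classes: decomposable if "C \<subseteq> V" "card C = 2" "\<And>x y. x \<in> V \<Longrightarrow> y \<in> V \<Longrightarrow> (x \<in> C) \<noteq> (y \<in> C) \<Longrightarrow> degree x \<noteq> degree y" for C
  proof (rule decomposable_two_blocks [of C "V - C"])
    have "finite C" using that(1) finite_V by (rule finite_subset)
    then show "card (V - C) = 3" using that(1,2) card by (simp add: card_Diff_subset)
    show "V = C \<union> (V - C)" "C \<inter> (V - C) = {}" using that(1) by blast+
    show "t ((i, l) # ws) = 0" if "i \<in> V" "l \<in> V" "(i \<in> C) \<noteq> (l \<in> C)" for i l ws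
      using that by (intro degree_orth \<open>\<And>x y. x \<in> V \<Longrightarrow> y \<in> V \<Longrightarrow> (x \<in> C) \<noteq> (y \<in> C) \<Longrightarrow> degree x \<noteq> degree y\<close>)
  qed (rule that(2))
  have "V \<noteq> {}" using card by auto
  then obtain x where x: "x \<in> V" by blast
  define C where "C = {y \<in> V. degree y = degree x}"
  have C: "C \<subseteq> V" "x \<in> C" "finite C" using x finite_V by (auto simp: C_def)
  have "card C \<le> 5" using card C(1) finite_V by (metis card_mono)
  moreover have "card C \<noteq> 0" using C by auto
  ultimately consider "card C = 1" | "card C = 2" | "card C = 3" | "card C = 4" | "card C = 5"
    by linarith
  then show ?thesis
  proof cases
    case 1
    then have "C = {x}" using C(2) by (auto simp: card_1_singleton_iff)
    then show ?thesis using x by (intro unique_degree [of x]) (auto simp: C_def)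
  next
    case 2
    show ?thesis by (rule two_classes [OF C(1) 2]) (auto simp: C_def)
  next
    case 3
    have "card (V - C) = 2" using 3 C card by (simp add: card_Diff_subset)
    then show ?thesis by (rule two_classes [rotated]) (auto simp: C_def)
  next
    case 4
    have "card (V - C) = 1" using 4 C card by (simp add: card_Diff_subset)
    then obtain v where v: "V - C = {v}" by (auto simp: card_1_singleton_iff)
    then have "v \<in> V - C" by simp
    then have vC: "v \<in> V" "degree v \<noteq> degree x" by (simp_all add: C_def)
    show ?thesis
    proof (rule unique_degree [OF vC(1)])
      fix y assume "y \<in> V" "degree y = degree v"
      then have "y \<in> V - C" using vC(2) by (simp add: C_def)
      then show "y = v" unfolding v by simp
    qed
  next
    case 5
    then have "C = V" using C(1) card finite_V by (intro card_subset_eq) auto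
    then have regular: "degree y = degree x" if "y \<in> V" for y using that by (auto simp: C_def)
    have "nbrs x \<subseteq> V - {x}" using nbrs_subset nbrs_irrefl by blast
    then have "card (nbrs x) \<le> card (V - {x})" using finite_V by (intro card_mono) auto
    then have "degree x \<le> 4" using x card finite_V by (simp add: degree_def)
    \<comment> \<open>The degree sum is five times the common degree and is even.\<close>
    moreover have "even (degree x)" using even_degree_sum card by (simp add: regular)
    moreover have "degree x \<noteq> 0" "degree x \<noteq> 4" using not_empty not_complete regular by auto
    ultimately have "degree x = 2" by presburger
    then show ?thesis using card regular by (intro decomposable_five_cycle) auto
  qed
qed

end

theorem proposition6p3:
  fixes G :: "'v pair_pre_digraph"
  assumes "pair_graph G" and "card (pverts G) = 5"
    and "\<not> K\<^bsub>5\<^esub> (with_proj G)"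
    and "\<not> K\<^bsub>5\<^esub> (with_proj (graph_complement G))"
  shows "\<not> nonlocal_symmetry TYPE('h::complex_hilbert_space) G"
proof
  interpret pair_graph G by fact
  assume "nonlocal_symmetry TYPE('h) G"
  then obtain p where p: "winning G p" "quantum_correlation TYPE('h) G p" "\<not> winning_classical G p"
    by (auto simp: nonlocal_symmetry_def)
  from p(2) obtain \<psi> :: 'h and M N :: "'v \<Rightarrow> 'v \<Rightarrow> 'h \<Rightarrow> 'h" where
    norm: "norm \<psi> = 1"
    and psd: "\<forall>i\<in>pverts G. \<forall>l\<in>pverts G. positive_semidefinite (M i l) \<and> positive_semidefinite (N i l)"
    and sums: "\<forall>i\<in>pverts G. \<forall>x. (\<Sum>l\<in>pverts G. M i l x) = x \<and> (\<Sum>l\<in>pverts G. N i l x) = x"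
    and comm: "\<forall>i\<in>pverts G. \<forall>l\<in>pverts G. \<forall>j\<in>pverts G. \<forall>k\<in>pverts G. M i l \<circ> N j k = N j k \<circ> M i l"
    and corr: "\<forall>l\<in>pverts G. \<forall>k\<in>pverts G. \<forall>i\<in>pverts G. \<forall>j\<in>pverts G.
      complex_of_real (p l k i j) = cinner \<psi> (M i l (N j k \<psi>))"
    unfolding quantum_correlation_def by blast
  interpret S: perfect_strategy G p \<psi> M N
  proof
    show "M i l (N j k x) = N j k (M i l x)"
      if "i \<in> pverts G" "l \<in> pverts G" "j \<in> pverts G" "k \<in> pverts G" for i l j k x
      using comm that by (metis comp_apply)
    show "p l k i j = rinner \<psi> (M i l (N j k \<psi>))"
      if "i \<in> pverts G" "l \<in> pverts G" "j \<in> pverts G" "k \<in> pverts G" for i l j k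
      using corr that by (metis Re_complex_of_real rinner_def)
  qed (use pair_finite_verts norm psd sums p(1) in auto)
  interpret T: graph_trace G S.moment by (rule S.moment_trace)
  interpret T: pair_graph_trace G S.moment ..
  \<comment> \<open>If all degrees were zero, the complement would be complete; likewise all degrees
    equal to 4 would make \<open>G\<close> complete.\<close>
  have "\<exists>i\<in>pverts G. T.degree i \<noteq> 0"
  proof (rule ccontr)
    assume "\<not> ?thesis"
    then have "T.nbrs i = {}" if "i \<in> pverts G" for i
      using that T.finite_nbrs by (auto simp: T.degree_def)
    then have "(i, j) \<notin> parcs G" for i j
      using in_arcsD1 [of i j] by (auto simp: T.nbrs_def)
    then have "K\<^bsub>5\<^esub> (with_proj (graph_complement G))"
      using assms(2) pair_finite_verts unfolding complete_digraph_pair_def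
      by (auto simp: graph_complement_def)
    with assms(4) show False by contradiction
  qed
  moreover have "\<exists>i\<in>pverts G. T.degree i \<noteq> 4"
  proof (rule ccontr)
    assume "\<not> ?thesis"
    then have "T.nbrs i = pverts G - {i}" if "i \<in> pverts G" for i
      using that assms(2) pair_finite_verts T.nbrs_subset T.nbrs_irrefl
      by (intro card_subset_eq) (auto simp: T.degree_def)
    then have "j \<in> T.nbrs i \<longleftrightarrow> i \<in> pverts G \<and> j \<in> pverts G \<and> i \<noteq> j" for i j
      using in_arcsD1 [of i j] by (cases "i \<in> pverts G") (auto simp: T.nbrs_def)
    then have "(i, j) \<in> parcs G \<longleftrightarrow> i \<in> pverts G \<and> j \<in> pverts G \<and> i \<noteq> j" for i j
      by (simp add: T.nbrs_def)
    then have "K\<^bsub>5\<^esub> (with_proj G)"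
      using assms(2) pair_finite_verts unfolding complete_digraph_pair_def by auto
    with assms(3) show False by contradiction
  qed
  ultimately have "T.decomposable" by (rule T.decomposable_five_vertices [OF assms(2)])
  moreover have "pverts G \<noteq> {}" using assms(2) by auto
  ultimately have "winning_classical G p"
    by (rule T.winning_classicalI) (rule S.corr_eq_moment)
  with p(3) show False by contradiction
qed

end
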